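(* The generating function for the pair $(\mathsf{des},\mathsf{ides})$ on permutations is given by $$\sum_{n=0}^{\infty}\sum_{\pi\in\mathfrak{S}_n}\frac{u^{\mathsf{des}(\pi)}x^{\mathsf{ides}(\pi)}t^n}{(1-u)^{n+1}(1-x)^{n+1}}=\sum_{n=1}^{\infty}\frac{t(1-t)^{n-1}(u-1)^{-1}}{u^n\big(1-x(1-t)^{n-1}\big)\big(1-x(1-t)^{n}\big)}+\frac{1}{(u-1)(x-1)}=\sum_{n=1}^{\infty}\sum_{k=1}^{\infty}\frac{x^{n-1}u^{k-1}}{(1-t)^{kn}}.$$
   Context: $\mathfrak{S}_n$ is the set of permutations of $\{1,\dots,n\}$; $\mathfrak{S}_0$ consists of the empty permutation, for which both statistics are $0$. $\mathsf{des}(\pi)=|\{i\in[n-1]:\pi_i>\pi_{i+1}\}|$ and $\mathsf{ides}(\pi)=\mathsf{des}(\pi^{-1})$. The identities are between formal power series in $t$ whose coefficients are rational functions of $x$ and $u$: the coefficient of each power of $t$ in the middle expression is to be read as the rational function obtained by summing the series in powers of $u^{-1}$, and the coefficient of each power of $t$ in the last expression as the rational function whose expansion in powers of $x$ and $u$ is displayed. *)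

theory Defs
  imports
    "HOL-Computational_Algebra.Computational_Algebra"
    "HOL-Computational_Algebra.Field_as_Ring"
    "HOL-Combinatorics.Permutations"
begin

definition des :: "nat \<Rightarrow> (nat \<Rightarrow> nat) \<Rightarrow> nat" where
  "des n \<pi> = card {i \<in> {1..n-1}. \<pi> i > \<pi> (i + 1)}"

definition ides :: "nat \<Rightarrow> (nat \<Rightarrow> nat) \<Rightarrow> nat" where
  "ides n \<pi> = des n (inv \<pi>)"

text \<open>
  The field of rational functions in \<open>x\<close> and \<open>u\<close>, as the fraction field of \<open>\<rat>[x][u]\<close>:
  the outer polynomial variable is \<open>u\<close> and the inner one is \<open>x\<close>.
\<close>

type_synonym ratfun = "rat poly poly fract"

definition rf_x :: ratfun where
  "rf_x = to_fract [:[:0, 1:]:]"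

definition rf_u :: ratfun where
  "rf_u = to_fract [:0, 1:]"

text \<open>
  Expansion in powers of \<open>1/u\<close>: the embedding of the field of rational functions into the
  Laurent series over \<open>\<rat>(x)\<close> in the variable \<open>1/u\<close>. Thus \<open>fls_X\<close> stands for
  \<open>1/u\<close>, and \<open>u\<close> is sent to \<open>fls_X_inv\<close>. Convergence (\<open>sums\<close>) refers to
  the library's metric on Laurent series, here the \<open>(1/u)\<close>-adic one.
\<close>

definition poly_at_inf :: "rat poly poly \<Rightarrow> rat poly fract fls" where
  "poly_at_inf p = poly (map_poly (\<lambda>c. fls_const (to_fract c)) p) fls_X_inv"

definition expand_at_inf :: "ratfun \<Rightarrow> rat poly fract fls" where
  "expand_at_inf r =
     poly_at_inf (fst (quot_of_fract r)) / poly_at_inf (snd (quot_of_fract r))"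

definition rf_sums :: "(nat \<Rightarrow> ratfun) \<Rightarrow> ratfun \<Rightarrow> bool" where
  "rf_sums f r \<longleftrightarrow> (\<lambda>n. expand_at_inf (f n)) sums expand_at_inf r"

definition rf_suminf :: "(nat \<Rightarrow> ratfun) \<Rightarrow> ratfun" where
  "rf_suminf f = (THE r. rf_sums f r)"

text \<open>
  Expansion in powers of \<open>x\<close> and \<open>u\<close>: the outer power series variable is \<open>u\<close> and
  the inner one is \<open>x\<close>, so that \<open>s $ j $ i\<close> is the coefficient of \<open>x^i * u^j\<close>.
  As not every rational function has such an expansion, this is a relation.
\<close>

definition poly_at_0 :: "rat poly poly \<Rightarrow> rat fps fps" where
  "poly_at_0 p = fps_of_poly (map_poly fps_of_poly p)"

definition has_expansion_at_0 :: "ratfun \<Rightarrow> rat fps fps \<Rightarrow> bool" where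
  "has_expansion_at_0 r s \<longleftrightarrow>
     poly_at_0 (snd (quot_of_fract r)) * s = poly_at_0 (fst (quot_of_fract r))"

definition ratfun_of_expansion :: "rat fps fps \<Rightarrow> ratfun" where
  "ratfun_of_expansion s = (THE r. has_expansion_at_0 r s)"

text \<open>In the following power series over \<open>ratfun\<close>, \<open>fps_X\<close> is the variable \<open>t\<close>.\<close>

definition des_ides_gf :: "ratfun fps" where
  "des_ides_gf = Abs_fps (\<lambda>n. \<Sum>\<pi> | \<pi> permutes {1..n}.
     rf_u ^ des n \<pi> * rf_x ^ ides n \<pi> / ((1 - rf_u) ^ (n + 1) * (1 - rf_x) ^ (n + 1)))"

definition middle_term :: "nat \<Rightarrow> ratfun fps" where
  "middle_term n =
     fps_X * (1 - fps_X) ^ (n - 1) * fps_const (inverse (rf_u - 1)) /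
     (fps_const (rf_u ^ n) * (1 - fps_const rf_x * (1 - fps_X) ^ (n - 1))
                           * (1 - fps_const rf_x * (1 - fps_X) ^ n))"

text \<open>The sums over \<open>n \<ge> 1\<close> and \<open>k \<ge> 1\<close> are reindexed to start at \<open>0\<close>.\<close>

definition middle_gf :: "ratfun fps" where
  "middle_gf = Abs_fps (\<lambda>m. rf_suminf (\<lambda>n. middle_term (n + 1) $ m))
     + fps_const (1 / ((rf_u - 1) * (rf_x - 1)))"

definition double_series :: "nat \<Rightarrow> rat fps fps" where
  "double_series m =
     Abs_fps (\<lambda>k. Abs_fps (\<lambda>n. (1 / (1 - fps_X) ^ ((k + 1) * (n + 1)) :: rat fps) $ m))"

definition double_gf :: "ratfun fps" where
  "double_gf = Abs_fps (\<lambda>m. ratfun_of_expansion (double_series m))"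

end

theory Submission
  imports Defs "HOL-Library.Product_Lexorder"
begin

text \<open>
  A word \<open>e\<close> over \<open>{0..<J*l}\<close> that weakly increases is a pair of words \<open>e div l\<close>, \<open>e mod l\<close>.
  Standardizing the second word gives a permutation \<open>\<pi>\<close>; then \<open>e div l\<close> increases weakly, and strictly
  at the descents of \<open>\<pi>\<close>, and the sorted rearrangement of \<open>e mod l\<close> does the same for \<open>\<pi>\<inverse>\<close>.
  Counting yields
  \<open>C(J l + m - 1, m) = \<Sum>\<^sub>\<pi> C(J + m - 1 - des \<pi>, m) C(l + m - 1 - ides \<pi>, m)\<close>,
  which is the equality of the first and the last expression. As an identity of polynomials in \<open>J\<close> it may
  be evaluated at \<open>-J\<close>; the result determines the coefficients of \<open>1 / (1 - x (1-t)^n)\<close> as rational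
  functions of \<open>x\<close>. The terms of the middle expression are differences of two such series, which turns the
  middle sum into the expansion in \<open>1/u\<close> of the first expression.
\<close>

section \<open>Words with weak and strict ascents, and their number\<close>

definition compat_words :: "nat \<Rightarrow> nat \<Rightarrow> nat set \<Rightarrow> (nat \<Rightarrow> nat) set" where
  "compat_words m N D = {c \<in> {1..m} \<rightarrow>\<^sub>E {..<N}.
     \<forall>i\<in>{1..<m}. c i \<le> c (i + 1) \<and> (i \<in> D \<longrightarrow> c i < c (i + 1))}"

lemma finite_compat_words: "finite (compat_words m N D)"
proof (rule finite_subset)
  show "compat_words m N D \<subseteq> {1..m} \<rightarrow>\<^sub>E {..<N}"
    unfolding compat_words_def by blast
qed (auto intro: finite_PiE)

lemma compat_words_mono:
  assumes "c \<in> compat_words m N D" "1 \<le> i" "i \<le> j" "j \<le> m"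
  shows "c i \<le> c j"
  using assms(3,4)
proof (induction j rule: dec_induct)
  case (step n)
  then have "c n \<le> c (n + 1)"
    using assms(1,2) unfolding compat_words_def by simp
  with step show ?case by simp
qed simp

text \<open>The words increase weakly, so the last letter bounds all others: excluding
  \<open>N\<close> as last letter excludes it everywhere.\<close>

lemma compat_words_Suc_less:
  "{c \<in> compat_words (Suc m) (Suc N) D. c (Suc m) < N} = compat_words (Suc m) N D" (is "?A = ?B")
proof
  show "?A \<subseteq> ?B"
  proof
    fix c assume c: "c \<in> ?A"
    have "c i < N" if "i \<in> {1..Suc m}" for i
      using compat_words_mono[of c "Suc m" "Suc N" D i "Suc m"] c that by auto
    then show "c \<in> ?B" using c unfolding compat_words_def by (auto simp: PiE_iff)
  qed
  show "?B \<subseteq> ?A"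
  proof
    fix c assume c: "c \<in> ?B"
    then have lt: "c i < N" if "i \<in> {1..Suc m}" for i
      using that unfolding compat_words_def by blast
    moreover have "c \<in> extensional {1..Suc m}"
      using c unfolding compat_words_def PiE_iff by blast
    ultimately have "c \<in> {1..Suc m} \<rightarrow>\<^sub>E {..<Suc N}"
      unfolding PiE_iff by (meson less_SucI lessThan_iff)
    with c lt show "c \<in> ?A" unfolding compat_words_def by simp
  qed
qed

text \<open>Deleting a last letter \<open>N\<close> leaves a word whose letters are at most
  \<open>N\<close>, and below \<open>N\<close> if the step at \<open>m\<close> must be strict. Both
  directions are point updates, \<open>undefined\<close> being the value outside the domain of an
  extensional function.\<close>

lemma compat_words_Suc_eq:
  "bij_betw (\<lambda>c. c(Suc m := N)) (compat_words m (if m \<in> D then N else Suc N) D)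
     {c \<in> compat_words (Suc m) (Suc N) D. c (Suc m) = N}"
  (is "bij_betw _ ?A ?B")
proof (rule bij_betwI[where g = "\<lambda>c. c(Suc m := undefined)"])
  show "(\<lambda>c. c(Suc m := N)) \<in> ?A \<rightarrow> ?B"
  proof
    fix c assume c: "c \<in> ?A"
    then have lt: "c i < (if m \<in> D then N else Suc N)" if "i \<in> {1..m}" for i
      using that unfolding compat_words_def PiE_iff by blast
    have "(c(Suc m := N)) i < Suc N" if "i \<in> {1..Suc m}" for i
      using lt[of i] that by (auto simp: less_Suc_eq split: if_splits)
    moreover have "(c(Suc m := N)) i = undefined" if "i \<notin> {1..Suc m}" for i
      using c that unfolding compat_words_def PiE_iff extensional_def by auto
    ultimately have "c(Suc m := N) \<in> {1..Suc m} \<rightarrow>\<^sub>E {..<Suc N}"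
      by (intro PiE_I) auto
    moreover have "(c(Suc m := N)) i \<le> (c(Suc m := N)) (i + 1) \<and>
        (i \<in> D \<longrightarrow> (c(Suc m := N)) i < (c(Suc m := N)) (i + 1))" if "i \<in> {1..<Suc m}" for i
    proof (cases "i = m")
      case True
      with that lt[of i] show ?thesis by (auto split: if_splits)
    next
      case False
      with c that show ?thesis unfolding compat_words_def by simp
    qed
    ultimately show "c(Suc m := N) \<in> ?B"
      unfolding compat_words_def by simp
  qed
  show "(\<lambda>c. c(Suc m := undefined)) \<in> ?B \<rightarrow> ?A"
  proof
    fix c assume c: "c \<in> ?B"
    have lt: "c i < (if m \<in> D then N else Suc N)" if "i \<in> {1..m}" for i
    proof -
      have "m \<in> {1..<Suc m}" using that by auto
      then have "c m \<le> N \<and> (m \<in> D \<longrightarrow> c m < N)"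
        using c unfolding compat_words_def by fastforce
      moreover have "c i \<le> c m"
        using compat_words_mono[of c "Suc m" "Suc N" D i m] c that by simp
      ultimately show ?thesis by (auto simp: less_Suc_eq_le)
    qed
    moreover have "(c(Suc m := undefined)) i = undefined" if "i \<notin> {1..m}" for i
      using c that unfolding compat_words_def PiE_iff extensional_def by auto
    ultimately have "c(Suc m := undefined) \<in> {1..m} \<rightarrow>\<^sub>E {..<(if m \<in> D then N else Suc N)}"
      by (intro PiE_I) simp_all
    then show "c(Suc m := undefined) \<in> ?A"
      using c unfolding compat_words_def by simp
  qed
  show "(c(Suc m := N))(Suc m := undefined) = c" if "c \<in> ?A" for c
    using that unfolding compat_words_def PiE_iff extensional_def by (simp add: fun_upd_idem)
  show "(c(Suc m := undefined))(Suc m := N) = c" if "c \<in> ?B" for c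
    using that by (simp add: fun_upd_idem)
qed

text \<open>Words are split by whether the last letter is \<open>N\<close> or smaller; this is
  Pascal's rule in combinatorial form.\<close>

lemma card_compat_words_Suc:
  "card (compat_words (Suc m) (Suc N) D) =
     card (compat_words (Suc m) N D) + card (compat_words m (if m \<in> D then N else Suc N) D)"
proof -
  let ?W = "compat_words (Suc m) (Suc N) D"
  let ?L = "{c \<in> ?W. c (Suc m) < N}" and ?E = "{c \<in> ?W. c (Suc m) = N}"
  have "c (Suc m) < Suc N" if "c \<in> ?W" for c
    using that unfolding compat_words_def by (simp add: PiE_iff)
  then have split: "?W = ?L \<union> ?E"
    by (auto simp: less_Suc_eq)
  have fin: "finite ?L" "finite ?E"
    using finite_compat_words[of "Suc m" "Suc N" D] by (auto intro: rev_finite_subset)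
  have "card ?W = card (?L \<union> ?E)"
    using split by (rule arg_cong)
  also have "\<dots> = card ?L + card ?E"
    by (rule card_Un_disjoint[OF fin]) blast
  finally have "card ?W = card ?L + card ?E" .
  moreover have "card ?E = card (compat_words m (if m \<in> D then N else Suc N) D)"
    using bij_betw_same_card[OF compat_words_Suc_eq[of m N D]] by (rule sym)
  ultimately show ?thesis
    by (simp only: compat_words_Suc_less)
qed

text \<open>Lowering each letter by the number of forced strict steps before it would give weakly
  increasing words, that is, multisets; the proof checks the formula by induction along the
  recursion. For \<open>m > 0\<close> the number of forced steps is at most \<open>m - 1\<close>, so
  the subtraction does not truncate.\<close>

lemma card_compat_words:
  "card (compat_words m N D) = (N + m - 1 - card (D \<inter> {1..<m})) choose m"
proof (induction m arbitrary: N)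
  case 0
  then show ?case by (simp add: compat_words_def)
next
  case (Suc m)
  note IH = Suc.IH
  let ?d = "\<lambda>k. card (D \<inter> {1..<k})"
  have le: "?d k \<le> k - 1" for k
    by (metis Int_lower2 card_atLeastLessThan card_mono finite_atLeastLessThan)
  show ?case
  proof (induction N)
    case 0
    have "compat_words (Suc m) 0 D = {}"
      using PiE_eq_empty_iff[of "{1..Suc m}" "\<lambda>_. {..<0}"] unfolding compat_words_def by auto
    then show ?case using le[of "Suc m"] by (simp add: binomial_eq_0)
  next
    case (Suc N)
    have "card (compat_words m (if m \<in> D then N else Suc N) D) = (N + m - ?d (Suc m)) choose m"
    \<comment> \<open>Position 0 is not counted even if it lies in \<open>D\<close>; for
      \<open>m = 0\<close> the coefficient is 1 in any case.\<close>
    proof (cases "m \<in> D \<and> m \<noteq> 0")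
      case True
      then have "D \<inter> {1..<Suc m} = insert m (D \<inter> {1..<m})" by auto
      moreover have "card (insert m (D \<inter> {1..<m})) = Suc (?d m)" by simp
      ultimately have "?d (Suc m) = Suc (?d m)" by (rule ssubst)
      with True show ?thesis by (simp add: IH)
    next
      case False
      then have "D \<inter> {1..<Suc m} = D \<inter> {1..<m}" by (force simp: less_Suc_eq)
      then have "?d (Suc m) = ?d m" by (rule arg_cong)
      with False show ?thesis unfolding IH by (cases "m = 0") auto
    qed
    moreover have "Suc N + Suc m - 1 - ?d (Suc m) = Suc (N + m - ?d (Suc m))"
      using le[of "Suc m"] by simp
    ultimately show ?case
      using Suc.IH by (simp only: card_compat_words_Suc binomial_Suc_Suc) simp
  qed
qed

section \<open>Standardization and the counting bijection\<close>

lemma des_conv_card: "des m \<pi> = card ({i. \<pi> i > \<pi> (i + 1)} \<inter> {1..<m})"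
  unfolding des_def by (rule arg_cong[of _ _ card]) auto

lemma des_le: "des m \<pi> \<le> m - 1"
  unfolding des_conv_card by (metis Int_lower2 card_atLeastLessThan card_mono finite_atLeastLessThan)

text \<open>\<open>\<pi>\<close> maps the set in question bijectively onto
  \<open>{1..\<pi> i}\<close>. Hence the relative order of its values determines a
  permutation.\<close>

lemma permutes_rank:
  assumes "\<pi> permutes {1..m}" "i \<in> {1..m}"
  shows "card {j \<in> {1..m}. \<pi> j \<le> \<pi> i} = \<pi> i"
proof -
  have "\<pi> i \<le> m" using permutes_in_image[OF assms(1), of i] assms(2) by simp
  have "\<pi> ` {j \<in> {1..m}. \<pi> j \<le> \<pi> i} = {1..\<pi> i}"
  proof
    show "\<pi> ` {j \<in> {1..m}. \<pi> j \<le> \<pi> i} \<subseteq> {1..\<pi> i}"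
      using permutes_in_image[OF assms(1)] by fastforce
    show "{1..\<pi> i} \<subseteq> \<pi> ` {j \<in> {1..m}. \<pi> j \<le> \<pi> i}"
    proof
      fix k assume k: "k \<in> {1..\<pi> i}"
      then have "k \<in> \<pi> ` {1..m}" using permutes_image[OF assms(1)] \<open>\<pi> i \<le> m\<close> by auto
      with k show "k \<in> \<pi> ` {j \<in> {1..m}. \<pi> j \<le> \<pi> i}" by auto
    qed
  qed
  moreover have "inj_on \<pi> {j \<in> {1..m}. \<pi> j \<le> \<pi> i}"
    using permutes_inj[OF assms(1)] inj_on_subset by blast
  ultimately have "card {j \<in> {1..m}. \<pi> j \<le> \<pi> i} = card {1..\<pi> i}"
    using card_image by fastforce
  then show ?thesis by simp
qed

text \<open>Standardization of a sequence of distinct values: each is replaced by its rank.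
  Uniqueness holds because a permutation equals its own ranks, by
  \<open>permutes_rank\<close>.\<close>

lemma ex1_permutes_rank:
  fixes f :: "nat \<Rightarrow> 'a :: linorder"
  assumes "inj_on f {1..m}"
  shows "\<exists>!\<pi>. \<pi> permutes {1..m} \<and> (\<forall>i\<in>{1..m}. \<forall>j\<in>{1..m}. \<pi> i < \<pi> j \<longleftrightarrow> f i < f j)"
proof (rule ex_ex1I)
  define r where "r i = card {j \<in> {1..m}. f j \<le> f i}" for i
  define \<pi> where "\<pi> i = (if i \<in> {1..m} then r i else i)" for i
  have mono: "r i < r j" if "i \<in> {1..m}" "j \<in> {1..m}" "f i < f j" for i j
    unfolding r_def
  proof (rule psubset_card_mono)
    have "j \<in> {k \<in> {1..m}. f k \<le> f j} - {k \<in> {1..m}. f k \<le> f i}" using that by simp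
    then show "{k \<in> {1..m}. f k \<le> f i} \<subset> {k \<in> {1..m}. f k \<le> f j}" using that by auto
  qed simp
  have mono_iff: "r i < r j \<longleftrightarrow> f i < f j" if "i \<in> {1..m}" "j \<in> {1..m}" for i j
  proof (cases "f i" "f j" rule: linorder_cases)
    case equal
    then have "i = j" using assms that by (meson inj_onD)
    then show ?thesis by simp
  qed (use mono[of i j] mono[of j i] that in auto)
  have "bij_betw r {1..m} {1..m}"
  proof -
    have "inj_on r {1..m}"
    proof (rule inj_onI)
      fix i j assume ij: "i \<in> {1..m}" "j \<in> {1..m}" "r i = r j"
      then have "f i = f j" using mono_iff[of i j] mono_iff[of j i] by auto
      then show "i = j" using assms ij by (meson inj_onD)
    qed
    moreover have "r i \<in> {1..m}" if "i \<in> {1..m}" for i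
    proof -
      have "card {i} \<le> r i" unfolding r_def by (rule card_mono) (use that in auto)
      moreover have "r i \<le> card {1..m}" unfolding r_def by (rule card_mono) auto
      ultimately show ?thesis by simp
    qed
    then have "r ` {1..m} \<subseteq> {1..m}" by blast
    ultimately show ?thesis by (metis bij_betw_def endo_inj_surj finite_atLeastAtMost)
  qed
  then have "\<pi> permutes {1..m}"
    using bij_betw_cong[of "{1..m}" r \<pi> "{1..m}"]
    by (intro bij_imp_permutes) (simp_all only: \<pi>_def if_True if_False simp_thms)
  then show "\<exists>\<pi>. \<pi> permutes {1..m} \<and> (\<forall>i\<in>{1..m}. \<forall>j\<in>{1..m}. \<pi> i < \<pi> j \<longleftrightarrow> f i < f j)"
    using mono_iff unfolding \<pi>_def by auto
next
  fix \<pi> \<sigma>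
  assume p: "\<pi> permutes {1..m} \<and> (\<forall>i\<in>{1..m}. \<forall>j\<in>{1..m}. \<pi> i < \<pi> j \<longleftrightarrow> f i < f j)"
    and s: "\<sigma> permutes {1..m} \<and> (\<forall>i\<in>{1..m}. \<forall>j\<in>{1..m}. \<sigma> i < \<sigma> j \<longleftrightarrow> f i < f j)"
  have "\<pi> i = \<sigma> i" if "i \<in> {1..m}" for i
  proof -
    have "{j \<in> {1..m}. \<pi> j \<le> \<pi> i} = {j \<in> {1..m}. \<sigma> j \<le> \<sigma> i}"
    proof (rule Collect_cong, rule conj_cong[OF refl])
      fix j assume "j \<in> {1..m}"
      then have "\<pi> i < \<pi> j \<longleftrightarrow> \<sigma> i < \<sigma> j" using p s that by simp
      then show "\<pi> j \<le> \<pi> i \<longleftrightarrow> \<sigma> j \<le> \<sigma> i" by (simp add: not_less[symmetric])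
    qed
    then show ?thesis using permutes_rank[of \<pi> m i] permutes_rank[of \<sigma> m i] p s that by simp
  qed
  then show "\<pi> = \<sigma>" using p s by (metis ext permutes_not_in)
qed

text \<open>At each single step either \<open>c\<close> grows, or \<open>c\<close> stays and then
  \<open>\<tau>\<close> has no descent there. So the pairs \<open>(c i, \<tau> i)\<close> increase
  lexicographically from one position to the next.\<close>

lemma compat_words_lex_strict_mono:
  assumes c: "c \<in> compat_words m N {i. \<tau> i > \<tau> (i + 1)}"
    and \<tau>: "\<tau> permutes {1..m}"
    and ij: "1 \<le> i" "i < j" "j \<le> m"
  shows "c i < c j \<or> c i = c j \<and> \<tau> i < \<tau> j"
  using ij(2,3)
proof (induction j)
  case (Suc j)
  have step: "c j < c (Suc j) \<or> c j = c (Suc j) \<and> \<tau> j < \<tau> (Suc j)" if "1 \<le> j" "j < m"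
  proof -
    have "\<tau> j \<noteq> \<tau> (Suc j)"
      using permutes_inj[OF \<tau>] by (simp add: inj_eq)
    moreover have "c j \<le> c (Suc j) \<and> (\<tau> j > \<tau> (Suc j) \<longrightarrow> c j < c (Suc j))"
      using c that unfolding compat_words_def by simp
    ultimately show ?thesis by linarith
  qed
  show ?case
  proof (cases "i = j")
    case True
    with step Suc.prems ij(1) show ?thesis by simp
  next
    case False
    with Suc have "c i < c j \<or> c i = c j \<and> \<tau> i < \<tau> j" by simp
    with step Suc.prems ij(1) show ?thesis by force
  qed
qed simp

text \<open>\<open>\<Phi>\<close> assembles letters in base \<open>l\<close>: the high digits are
  \<open>a\<close>, the low digits are the entries of the sorted word \<open>c\<close>, placed by
  \<open>\<pi>\<close>. Ties among low digits are broken by position, which makes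
  \<open>\<pi>\<close> recoverable from them.\<close>

lemma card_compat_pairs:
  "(\<Sum>\<pi> | \<pi> permutes {1..m}. card (compat_words m J {i. \<pi> i > \<pi> (i + 1)})
       * card (compat_words m l {i. inv \<pi> i > inv \<pi> (i + 1)}))
     = card (compat_words m (J * l) {})"
proof -
  let ?D = "\<lambda>\<pi>. {i. \<pi> i > \<pi> (i + 1)} :: nat set"
  let ?P = "{\<pi>. \<pi> permutes {1..m}}"
  let ?S = "SIGMA \<pi>:?P. compat_words m J (?D \<pi>) \<times> compat_words m l (?D (inv \<pi>))"
  define \<Phi> :: "(nat \<Rightarrow> nat) \<times> (nat \<Rightarrow> nat) \<times> (nat \<Rightarrow> nat) \<Rightarrow> nat \<Rightarrow> nat"
    where "\<Phi> = (\<lambda>(\<pi>, a, c). \<lambda>i\<in>{1..m}. a i * l + c (\<pi> i) :: nat)"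
  have "bij_betw \<Phi> ?S (compat_words m (J * l) {})"
    unfolding bij_betw_def
  proof
    \<comment> \<open>The last fact says that \<open>\<pi>\<close> is the standardization of the low
      digits; it is what makes \<open>\<Phi>\<close> injective and its values increasing.\<close>
    have props: "\<pi> permutes {1..m}" "inv \<pi> permutes {1..m}" 
        "\<And>i. i \<in> {1..m} \<Longrightarrow> \<pi> i \<in> {1..m}" "\<And>i. i \<in> {1..m} \<Longrightarrow> a i < J"
        "\<And>i. i \<in> {1..m} \<Longrightarrow> c i < l" "\<And>i. i \<in> {1..m} \<Longrightarrow> c (\<pi> i) < l"
        "\<And>i j. i \<in> {1..m} \<Longrightarrow> j \<in> {1..m} \<Longrightarrow> \<pi> i < \<pi> j \<longleftrightarrow> (c (\<pi> i), i) < (c (\<pi> j), j)"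
      if "(\<pi>, a, c) \<in> ?S" for \<pi> a c
    proof -
      show \<pi>: "\<pi> permutes {1..m}" using that by simp
      then show \<pi>': "inv \<pi> permutes {1..m}" by (rule permutes_inv)
      show in_m: "\<pi> i \<in> {1..m}" if "i \<in> {1..m}" for i
        using permutes_in_image[OF \<pi>] that by blast
      show "a i < J" if "i \<in> {1..m}" for i
        using \<open>(\<pi>, a, c) \<in> ?S\<close> that unfolding compat_words_def by auto
      show cl: "c i < l" if "i \<in> {1..m}" for i
        using \<open>(\<pi>, a, c) \<in> ?S\<close> that unfolding compat_words_def by auto
      show "c (\<pi> i) < l" if "i \<in> {1..m}" for i
        using in_m[OF that] cl by blast
      \<comment> \<open>The lexicographic lemma is applied to the inverse permutation, at the
        positions \<open>\<pi> i\<close> and \<open>\<pi> j\<close>, where it takes the values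
        \<open>i\<close> and \<open>j\<close>.\<close>
      have less: "(c (\<pi> i), i) < (c (\<pi> j), j)" if "i \<in> {1..m}" "j \<in> {1..m}" "\<pi> i < \<pi> j" for i j
        using compat_words_lex_strict_mono[of c m l "inv \<pi>" "\<pi> i" "\<pi> j"]
          \<open>(\<pi>, a, c) \<in> ?S\<close> \<pi>' in_m[OF that(1)] in_m[OF that(2)] that(3)
        by (auto simp: permutes_inverses[OF \<pi>])
      show "\<pi> i < \<pi> j \<longleftrightarrow> (c (\<pi> i), i) < (c (\<pi> j), j)" if "i \<in> {1..m}" "j \<in> {1..m}" for i j
      proof (cases "\<pi> i" "\<pi> j" rule: linorder_cases)
        case equal
        then have "i = j" using permutes_inj[OF \<pi>] by (simp add: inj_eq)
        then show ?thesis by (simp only: less_irrefl)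
      qed (use less[of i j] less[of j i] that in auto)
    qed
    show "inj_on \<Phi> ?S"
    proof (rule inj_onI)
      fix s s' assume s: "s \<in> ?S" and s': "s' \<in> ?S" and eq: "\<Phi> s = \<Phi> s'"
      obtain \<pi> a c where s_eq: "s = (\<pi>, a, c)" by (cases s) auto
      obtain \<pi>' a' c' where s'_eq: "s' = (\<pi>', a', c')" by (cases s') auto
      note p = props[OF s[unfolded s_eq]] and p' = props[OF s'[unfolded s'_eq]]
      have val: "a i * l + c (\<pi> i) = a' i * l + c' (\<pi>' i)" if "i \<in> {1..m}" for i
        using fun_cong[OF eq, of i] that unfolding s_eq s'_eq \<Phi>_def by simp
      have c_eq: "c (\<pi> i) = c' (\<pi>' i)" if "i \<in> {1..m}" for i
        using arg_cong[OF val[OF that], of "\<lambda>k. k mod l"] p(6)[OF that] p'(6)[OF that] by simp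
      have a_eq: "a i = a' i" if "i \<in> {1..m}" for i
        using val[OF that] c_eq[OF that] p(6)[OF that] by simp
      have "inj_on (\<lambda>i. (c (\<pi> i), i)) {1..m}" by (rule inj_onI) simp
      from ex1_permutes_rank[OF this] have "\<pi> = \<pi>'"
      proof (rule ex1E)
        fix \<rho>
        assume uniq: "\<forall>\<sigma>. \<sigma> permutes {1..m} \<and> (\<forall>i\<in>{1..m}. \<forall>j\<in>{1..m}.
          \<sigma> i < \<sigma> j \<longleftrightarrow> (c (\<pi> i), i) < (c (\<pi> j), j)) \<longrightarrow> \<sigma> = \<rho>"
        have "\<pi> = \<rho>" using uniq p(1,7) by blast
        moreover have "\<pi>' i < \<pi>' j \<longleftrightarrow> (c (\<pi> i), i) < (c (\<pi> j), j)"
          if "i \<in> {1..m}" "j \<in> {1..m}" for i j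
          using p'(7)[OF that] c_eq[OF that(1)] c_eq[OF that(2)] by simp
        then have "\<pi>' = \<rho>" using uniq p'(1) by blast
        ultimately show "\<pi> = \<pi>'" by simp
      qed
      moreover have "a = a'"
      proof (rule PiE_ext)
        show "a \<in> {1..m} \<rightarrow>\<^sub>E {..<J}" "a' \<in> {1..m} \<rightarrow>\<^sub>E {..<J}"
          using s s' unfolding s_eq s'_eq compat_words_def by simp_all
      qed (rule a_eq)
      moreover have "c = c'"
      proof (rule PiE_ext)
        show "c \<in> {1..m} \<rightarrow>\<^sub>E {..<l}" "c' \<in> {1..m} \<rightarrow>\<^sub>E {..<l}"
          using s s' unfolding s_eq s'_eq compat_words_def by simp_all
        fix k assume "k \<in> {1..m}"
        then have "inv \<pi> k \<in> {1..m}" using permutes_in_image[OF p(2)] by blast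
        from c_eq[OF this] show "c k = c' k"
          using \<open>\<pi> = \<pi>'\<close> by (simp add: permutes_inverses[OF p'(1)])
      qed
      ultimately show "s = s'" unfolding s_eq s'_eq by simp
    qed
    show "\<Phi> ` ?S = compat_words m (J * l) {}"
    proof
      show "\<Phi> ` ?S \<subseteq> compat_words m (J * l) {}"
      proof
        fix e assume "e \<in> \<Phi> ` ?S"
        then obtain s where s: "s \<in> ?S" and e: "e = \<Phi> s" by (rule imageE)
        obtain \<pi> a c where s_eq: "s = (\<pi>, a, c)" by (cases s) auto
        note s = s[unfolded s_eq] and e = e[unfolded s_eq]
        note p = props[OF s]
        have ev: "e i = a i * l + c (\<pi> i)" if "i \<in> {1..m}" for i
          using that unfolding e \<Phi>_def by simp
        \<comment> \<open>A low digit is below \<open>l\<close>, so a larger high digit outweighs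
          any difference of low digits.\<close>
        have carry: "a i * l + c (\<pi> i) < k * l" if "i \<in> {1..m}" "a i < k" for i k
        proof -
          have "a i * l + c (\<pi> i) < (a i + 1) * l" using p(6)[OF that(1)] by simp
          also have "\<dots> \<le> k * l" using that(2) by (intro mult_le_mono1) simp
          finally show ?thesis .
        qed
        have "e \<in> {1..m} \<rightarrow>\<^sub>E {..<J * l}"
        proof (rule PiE_I)
          fix i assume i: "i \<in> {1..m}"
          show "e i \<in> {..<J * l}" using carry[OF i p(4)[OF i]] ev[OF i] by simp
        next
          fix i assume i: "i \<notin> {1..m}"
          show "e i = undefined" unfolding e \<Phi>_def prod.case by (rule restrict_apply[THEN trans]) (simp only: i if_False)
        qed
        moreover have "e i \<le> e (i + 1)" if "i \<in> {1..<m}" for i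
        proof -
          have i: "i \<in> {1..m}" "i + 1 \<in> {1..m}" using that by auto
          have a: "a i \<le> a (i + 1)" "\<pi> i > \<pi> (i + 1) \<longrightarrow> a i < a (i + 1)"
            using s that unfolding compat_words_def by auto
          show ?thesis
          proof (cases "a i < a (i + 1)")
            case True
            from carry[OF i(1) this] show ?thesis unfolding ev[OF i(1)] ev[OF i(2)] by simp
          next
            case False
            \<comment> \<open>Equal high digits rule out a descent of \<open>\<pi>\<close>, so here
              the low digits cannot decrease.\<close>
            have "\<pi> i \<noteq> \<pi> (i + 1)" using permutes_inj[OF p(1)] by (simp add: inj_eq)
            with False a have "\<pi> i < \<pi> (i + 1)" by auto
            then have "c (\<pi> i) \<le> c (\<pi> (i + 1))" using p(7)[OF i] by auto
            with False a show ?thesis unfolding ev[OF i(1)] ev[OF i(2)] by simp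
          qed
        qed
        ultimately show "e \<in> compat_words m (J * l) {}" unfolding compat_words_def by simp
      qed
      show "compat_words m (J * l) {} \<subseteq> \<Phi> ` ?S"
      proof
        fix e assume e: "e \<in> compat_words m (J * l) {}"
        then have eP: "e \<in> {1..m} \<rightarrow>\<^sub>E {..<J * l}" unfolding compat_words_def by simp
        define b where "b i = e i mod l" for i
        have "inj_on (\<lambda>i. (b i, i)) {1..m}" by (rule inj_onI) simp
        from ex1_permutes_rank[OF this] obtain \<pi> where \<pi>: "\<pi> permutes {1..m}"
          and \<pi>_less: "\<And>i j. i \<in> {1..m} \<Longrightarrow> j \<in> {1..m} \<Longrightarrow> \<pi> i < \<pi> j \<longleftrightarrow> (b i, i) < (b j, j)"
          by blast
        define a where "a = (\<lambda>i\<in>{1..m}. e i div l)"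
        define c where "c = (\<lambda>k\<in>{1..m}. b (inv \<pi> k))"
        note \<pi>' = permutes_inv[OF \<pi>]
        have e_less: "e i < J * l" if "i \<in> {1..m}" for i using eP that by auto
        \<comment> \<open>For \<open>m = 0\<close> the word is empty and \<open>l\<close> may be 0;
          an index in the range is what forces \<open>l > 0\<close>.\<close>
        have l_pos: "l > 0" if "i \<in> {1..m}" for i using e_less[OF that] by (cases l) auto
        have in_m: "inv \<pi> k \<in> {1..m}" if "k \<in> {1..m}" for k
          using permutes_in_image[OF \<pi>'] that by blast
        have "a \<in> compat_words m J (?D \<pi>)"
        proof -
          have "a \<in> {1..m} \<rightarrow>\<^sub>E {..<J}"
            unfolding a_def using e_less by (intro restrict_PiE_iff[THEN iffD2]) (simp add: less_mult_imp_div_less)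
          moreover have "a i \<le> a (i + 1) \<and> (\<pi> i > \<pi> (i + 1) \<longrightarrow> a i < a (i + 1))" if "i \<in> {1..<m}" for i
          proof -
            have i: "i \<in> {1..m}" "i + 1 \<in> {1..m}" using that by auto
            have le: "e i \<le> e (i + 1)" using e that unfolding compat_words_def by simp
            then have "a i \<le> a (i + 1)" using i unfolding a_def by (simp add: div_le_mono)
            moreover have "a i \<noteq> a (i + 1)" if "\<pi> i > \<pi> (i + 1)"
            proof
              assume "a i = a (i + 1)"
              then have "e i div l = e (i + 1) div l" using i unfolding a_def by simp
              \<comment> \<open>As \<open>i < i + 1\<close>, a descent of \<open>\<pi>\<close>
                cannot come from a tie, so the low digit drops; equal high digits would then make
                \<open>e\<close> decrease.\<close>
              moreover have "b (i + 1) < b i" using \<pi>_less[OF i(2,1)] that by auto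
              ultimately have "e (i + 1) < e i"
                unfolding b_def by (metis div_mult_mod_eq nat_add_left_cancel_less)
              with le show False by simp
            qed
            ultimately show ?thesis by auto
          qed
          ultimately show ?thesis unfolding compat_words_def by simp
        qed
        moreover have "c \<in> compat_words m l (?D (inv \<pi>))"
        proof -
          have "c \<in> {1..m} \<rightarrow>\<^sub>E {..<l}"
            unfolding c_def b_def using l_pos by (intro restrict_PiE_iff[THEN iffD2]) simp
          moreover have "c i \<le> c (i + 1) \<and> (inv \<pi> i > inv \<pi> (i + 1) \<longrightarrow> c i < c (i + 1))" if "i \<in> {1..<m}" for i
          proof -
            have i: "i \<in> {1..m}" "i + 1 \<in> {1..m}" using that by auto
            \<comment> \<open>\<open>inv \<pi>\<close> lists the indices by increasing pair, so a
              tie of consecutive letters of \<open>c\<close> comes with increasing indices, that is,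
              without a descent of \<open>inv \<pi>\<close>.\<close>
            have "(b (inv \<pi> i), inv \<pi> i) < (b (inv \<pi> (i + 1)), inv \<pi> (i + 1))"
              using \<pi>_less[OF in_m in_m, OF i] by (simp add: permutes_inverses[OF \<pi>])
            then show ?thesis using i unfolding c_def by auto
          qed
          ultimately show ?thesis unfolding compat_words_def by simp
        qed
        moreover have "e = \<Phi> (\<pi>, a, c)"
        proof (rule extensionalityI)
          show "e \<in> extensional {1..m}" using eP unfolding PiE_iff by blast
          show "\<Phi> (\<pi>, a, c) \<in> extensional {1..m}" unfolding \<Phi>_def by simp
          fix i assume i: "i \<in> {1..m}"
          then have "\<pi> i \<in> {1..m}" using permutes_in_image[OF \<pi>] by blast
          with i show "e i = \<Phi> (\<pi>, a, c) i"
            unfolding \<Phi>_def a_def c_def b_def by (simp add: permutes_inverses[OF \<pi>])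
        qed
        ultimately show "e \<in> \<Phi> ` ?S" using \<pi> by blast
      qed
    qed
  qed
  from bij_betw_same_card[OF this] have "card ?S = card (compat_words m (J * l) {})" .
  moreover have "card ?S = (\<Sum>\<pi>\<in>?P. card (compat_words m J (?D \<pi>) \<times> compat_words m l (?D (inv \<pi>))))"
    by (rule card_SigmaI) (auto simp: finite_permutations finite_compat_words)
  ultimately show ?thesis by (simp add: card_cartesian_product)
qed

text \<open>A two-sided analogue of Worpitzky's identity: all three kinds of words are counted by
  \<open>card_compat_words\<close>.\<close>

lemma binomial_mult_eq_sum_permutes:
  "(J * l + m - 1) choose m = (\<Sum>\<pi> | \<pi> permutes {1..m}.
     ((J + m - 1 - des m \<pi>) choose m) * ((l + m - 1 - ides m \<pi>) choose m))"
  using card_compat_pairs[of m J l] by (simp add: card_compat_words des_conv_card ides_def)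

section \<open>The counting identity at negative arguments\<close>

lemma ides_le: "ides m \<pi> \<le> m - 1"
  unfolding ides_def by (rule des_le)

text \<open>Makes both sides of the counting identity polynomials in \<open>J\<close>: their
  difference has infinitely many roots, hence is zero.\<close>

definition gbinomial_poly :: "rat \<Rightarrow> rat \<Rightarrow> nat \<Rightarrow> rat poly" where
  "gbinomial_poly a b k = smult (1 / fact k) (\<Prod>i<k. [:b - of_nat i, a:])"

lemma poly_gbinomial_poly: "poly (gbinomial_poly a b k) z = (a * z + b) gchoose k"
proof -
  have "poly (gbinomial_poly a b k) z = (\<Prod>i<k. a * z + b - of_nat i) / fact k"
    unfolding gbinomial_poly_def by (simp add: poly_prod algebra_simps)
  also have "\<dots> = (a * z + b) gchoose k"
    by (simp add: gbinomial_prod_rev lessThan_atLeast0)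
  finally show ?thesis .
qed

text \<open>Both sides of the previous identity are polynomials in \<open>J\<close>; this is their value at \<open>-J\<close>.\<close>

lemma binomial_mult_eq_sum_permutes':
  assumes "m \<ge> 1"
  shows "(J * l) choose m = (\<Sum>\<pi> | \<pi> permutes {1..m}.
     ((J + des m \<pi>) choose m) * ((l + m - 1 - ides m \<pi>) choose m))"
proof -
  let ?P = "{\<pi>. \<pi> permutes {1..m}}"
  define b where "b \<pi> = (of_nat ((l + m - 1 - ides m \<pi>) choose m) :: rat)" for \<pi>
  \<comment> \<open>The difference of the two sides with \<open>z\<close> for \<open>J\<close>. As
    \<open>des m \<pi> \<le> m - 1\<close>, the subtraction \<open>m - 1 - des m \<pi>\<close> does
    not truncate.\<close>
  define p where "p = gbinomial_poly (of_nat l) (of_nat (m - 1)) m -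
    (\<Sum>\<pi>\<in>?P. smult (b \<pi>) (gbinomial_poly 1 (of_nat (m - 1 - des m \<pi>)) m))"
  have poly_p: "poly p z = ((of_nat l * z + of_nat (m - 1)) gchoose m) -
      (\<Sum>\<pi>\<in>?P. b \<pi> * ((z + of_nat (m - 1 - des m \<pi>)) gchoose m))" for z
    unfolding p_def by (simp add: poly_sum poly_gbinomial_poly)
  have "poly p (of_nat n) = 0" for n
  proof -
    have "of_nat l * of_nat n + of_nat (m - 1) = (of_nat (n * l + m - 1) :: rat)"
      using assms by (simp flip: of_nat_mult of_nat_add add: mult.commute del: of_nat_diff)
    moreover have "of_nat n + of_nat (m - 1 - des m \<pi>) = (of_nat (n + m - 1 - des m \<pi>) :: rat)" for \<pi>
      using assms des_le[of m \<pi>] by (simp flip: of_nat_add del: of_nat_diff)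
    ultimately show ?thesis
      unfolding poly_p b_def
      by (simp only: binomial_gbinomial[symmetric] binomial_mult_eq_sum_permutes[of n l m])
         (simp add: mult.commute)
  qed
  then have "range (of_nat :: nat \<Rightarrow> rat) \<subseteq> {z. poly p z = 0}"
    by (simp add: image_subset_iff)
  from infinite_super[OF this range_inj_infinite[OF inj_of_nat]] have "p = 0"
    using poly_roots_finite[of p] by argo
  then have "((of_nat l * (- of_nat J) + of_nat (m - 1)) gchoose m) =
      (\<Sum>\<pi>\<in>?P. b \<pi> * ((- of_nat J + of_nat (m - 1 - des m \<pi>)) gchoose m))"
    using poly_p[of "- of_nat J"] by simp
  \<comment> \<open>Reflecting the upper entry, \<open>z\<close> to \<open>m - 1 - z\<close>, costs
    the sign \<open>(-1) ^ m\<close>, which occurs on both sides and cancels.\<close>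
  moreover have "(of_nat l * (- of_nat J) + of_nat (m - 1)) gchoose m = (-1) ^ m * (of_nat ((J * l) choose m) :: rat)"
  proof -
    have "of_nat m - (of_nat l * (- of_nat J) + of_nat (m - 1)) - 1 = (of_nat (J * l) :: rat)"
      using assms by (simp add: of_nat_diff mult.commute)
    then show ?thesis by (subst gbinomial_negated_upper) (simp only: binomial_gbinomial)
  qed
  moreover have "(- of_nat J + of_nat (m - 1 - des m \<pi>)) gchoose m =
      (-1) ^ m * (of_nat ((J + des m \<pi>) choose m) :: rat)" for \<pi>
  proof -
    have "of_nat m - (- of_nat J + of_nat (m - 1 - des m \<pi>)) - 1 = (of_nat (J + des m \<pi>) :: rat)"
      using assms des_le[of m \<pi>] by (simp add: of_nat_diff)
    then show ?thesis by (subst gbinomial_negated_upper) (simp only: binomial_gbinomial)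
  qed
  ultimately have "(-1) ^ m * (of_nat ((J * l) choose m) :: rat) =
      (-1) ^ m * (\<Sum>\<pi>\<in>?P. b \<pi> * of_nat ((J + des m \<pi>) choose m))"
    by (simp add: sum_distrib_left mult.left_commute)
  then have "(of_nat ((J * l) choose m) :: rat) = (\<Sum>\<pi>\<in>?P. b \<pi> * of_nat ((J + des m \<pi>) choose m))"
    by simp
  also have "\<dots> = of_nat (\<Sum>\<pi>\<in>?P. ((J + des m \<pi>) choose m) * ((l + m - 1 - ides m \<pi>) choose m))"
    unfolding b_def by (simp add: mult.commute)
  finally show ?thesis by (simp only: of_nat_eq_iff)
qed

section \<open>Series of binomial coefficients\<close>

lemma Abs_fps_binomial_mult_power:
  assumes "d \<le> m"
  shows "Abs_fps (\<lambda>n. of_nat ((n + d) choose m)) * (1 - fps_X) ^ (m + 1) =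
    (fps_X ^ (m - d) :: 'a :: comm_ring_1 fps)"
proof -
  \<comment> \<open>The case \<open>d = m\<close>, where multiplication by \<open>1 - fps_X\<close>
    lowers \<open>m\<close> by Pascal's rule. A smaller \<open>d\<close> only shifts the series,
    since the coefficients with \<open>n < m - d\<close> vanish.\<close>
  define B where "B m = (Abs_fps (\<lambda>n. of_nat ((n + m) choose m)) :: 'a fps)" for m
  have B: "B m * (1 - fps_X) ^ (m + 1) = 1"
  proof (induction m)
    case 0
    show ?case unfolding B_def by (rule fps_ext) (simp add: algebra_simps)
  next
    case (Suc m)
    have "B (Suc m) * (1 - fps_X) = B m"
    proof (rule fps_ext)
      fix n show "(B (Suc m) * (1 - fps_X)) $ n = B m $ n"
        unfolding B_def by (cases n) (simp_all add: right_diff_distrib binomial_eq_0)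
    qed
    with Suc show ?case by (simp add: mult.assoc[symmetric])
  qed
  have "Abs_fps (\<lambda>n. of_nat ((n + d) choose m)) = fps_X ^ (m - d) * B m"
  proof (rule fps_ext)
    fix n
    show "Abs_fps (\<lambda>n. of_nat ((n + d) choose m)) $ n = (fps_X ^ (m - d) * B m) $ n"
      using assms unfolding B_def by (auto simp: fps_X_power_mult_nth binomial_eq_0)
  qed
  with B show ?thesis by (simp add: mult.assoc)
qed

lemma one_minus_fps_X_power_nth:
  "((1 - fps_X) ^ n :: 'a :: comm_ring_1 fps) $ k = (-1) ^ k * of_nat (n choose k)"
proof (induction n arbitrary: k)
  case (Suc n)
  then show ?case by (cases k) (simp_all add: algebra_simps)
qed (simp add: gr0_conv_Suc[of k] binomial_eq_0)

lemma inverse_one_minus_fps_X_power_nth: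
  "(1 / (1 - fps_X) ^ Suc n :: 'a :: field fps) $ m = of_nat ((n + m) choose m)"
proof -
  have "1 / (1 - fps_X) ^ Suc n = (Abs_fps (\<lambda>m. of_nat ((m + n) choose n)) :: 'a fps)"
  proof -
    have "inverse ((1 - fps_X) ^ Suc n) = (Abs_fps (\<lambda>m. of_nat ((m + n) choose n)) :: 'a fps)"
      using Abs_fps_binomial_mult_power[of n n, where 'a = 'a]
      by (intro fps_inverse_unique) (simp add: mult.commute)
    then show ?thesis by (subst fps_divide_unit) simp_all
  qed
  then show ?thesis using binomial_symmetric[of m "m + n"] by (simp add: add.commute)
qed

section \<open>Expansion in powers of x and u\<close>

lemma poly_at_0_nth: "poly_at_0 p $ n = fps_of_poly (coeff p n)"
  unfolding poly_at_0_def by (simp add: coeff_map_poly)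

lemma poly_at_0_add: "poly_at_0 (p + q) = poly_at_0 p + poly_at_0 q"
  by (rule fps_ext) (simp add: poly_at_0_nth fps_of_poly_add)

lemma poly_at_0_mult: "poly_at_0 (p * q) = poly_at_0 p * poly_at_0 q"
  by (rule fps_ext)
     (simp add: poly_at_0_nth coeff_mult fps_mult_nth fps_of_poly_sum fps_of_poly_mult atLeast0AtMost)

lemma poly_at_0_eq_iff: "poly_at_0 p = poly_at_0 q \<longleftrightarrow> p = q"
  by (simp add: fps_eq_iff[of "poly_at_0 p"] poly_at_0_nth fps_of_poly_eq_iff poly_eq_iff[of p])

lemma poly_at_0_0 [simp]: "poly_at_0 0 = 0"
  by (simp add: poly_at_0_def)

lemma poly_at_0_1 [simp]: "poly_at_0 1 = 1"
  by (rule fps_ext) (simp add: poly_at_0_nth)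

text \<open>Frees the expansion from the normalized numerator and denominator: any representing
  fraction will do, because \<open>poly_at_0\<close> is an injective ring homomorphism into an
  integral domain, where one may cross-multiply.\<close>

lemma has_expansion_at_0_quotient:
  assumes "q \<noteq> 0"
  shows "has_expansion_at_0 (to_fract p / to_fract q) s \<longleftrightarrow> poly_at_0 q * s = poly_at_0 p"
proof -
  define r where "r = to_fract p / to_fract q"
  define a where "a = fst (quot_of_fract r)"
  define b where "b = snd (quot_of_fract r)"
  have b: "b \<noteq> 0" unfolding b_def by simp
  have "to_fract a / to_fract b = to_fract p / to_fract q"
    using Fract_quot_of_fract[of r] unfolding a_def b_def r_def Fract_conv_to_fract .
  then have "to_fract (a * q) = to_fract (p * b)"
    using b assms by (simp add: field_simps)
  then have ab: "a * q = p * b" by (simp only: to_fract_eq_iff)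
  have "poly_at_0 b * s = poly_at_0 a \<longleftrightarrow> poly_at_0 q * s * poly_at_0 b = poly_at_0 p * poly_at_0 b"
  proof -
    have "poly_at_0 b * s = poly_at_0 a \<longleftrightarrow> poly_at_0 b * s * poly_at_0 q = poly_at_0 a * poly_at_0 q"
      using assms by (simp add: poly_at_0_eq_iff[of _ 0, simplified])
    also have "poly_at_0 a * poly_at_0 q = poly_at_0 p * poly_at_0 b"
      by (simp add: ab flip: poly_at_0_mult)
    finally show ?thesis by (simp add: ac_simps)
  qed
  also have "\<dots> \<longleftrightarrow> poly_at_0 q * s = poly_at_0 p"
    using b by (simp add: poly_at_0_eq_iff[of _ 0, simplified])
  finally show ?thesis unfolding has_expansion_at_0_def a_def b_def r_def .
qed

lemma has_expansion_at_0E: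
  assumes "has_expansion_at_0 r s"
  obtains p q where "q \<noteq> 0" "r = to_fract p / to_fract q" "poly_at_0 q * s = poly_at_0 p"
proof
  show "snd (quot_of_fract r) \<noteq> 0" by simp
  show "r = to_fract (fst (quot_of_fract r)) / to_fract (snd (quot_of_fract r))"
    using Fract_quot_of_fract[of r] unfolding Fract_conv_to_fract by simp
qed (use assms in \<open>simp add: has_expansion_at_0_def\<close>)

text \<open>For two fractions with the series \<open>s\<close>, the cross products have equal images
  under the injective \<open>poly_at_0\<close>. This is the uniqueness behind the \<open>THE\<close>
  in \<open>ratfun_of_expansion\<close>.\<close>

lemma has_expansion_at_0_unique:
  assumes "has_expansion_at_0 r s" "has_expansion_at_0 r' s"
  shows "r = r'"
proof -
  obtain p q where q: "q \<noteq> 0" "r = to_fract p / to_fract q" "poly_at_0 q * s = poly_at_0 p"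
    using assms(1) by (rule has_expansion_at_0E)
  obtain p' q' where q': "q' \<noteq> 0" "r' = to_fract p' / to_fract q'" "poly_at_0 q' * s = poly_at_0 p'"
    using assms(2) by (rule has_expansion_at_0E)
  have "poly_at_0 (q * p') = poly_at_0 (q' * p)"
    unfolding poly_at_0_mult q(3)[symmetric] q'(3)[symmetric] by (simp add: ac_simps)
  then have "to_fract (q * p') = to_fract (q' * p)" by (simp only: poly_at_0_eq_iff)
  with q(1) q'(1) show ?thesis
    unfolding q(2) q'(2) by (simp add: frac_eq_eq mult.commute)
qed

lemma has_expansion_at_0_to_fract: "has_expansion_at_0 (to_fract p) (poly_at_0 p)"
  using has_expansion_at_0_quotient[of 1 p] by simp

lemma has_expansion_at_0_add:
  assumes "has_expansion_at_0 r s" "has_expansion_at_0 r' s'"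
  shows "has_expansion_at_0 (r + r') (s + s')"
proof -
  obtain p q where q: "q \<noteq> 0" "r = to_fract p / to_fract q" "poly_at_0 q * s = poly_at_0 p"
    using assms(1) by (rule has_expansion_at_0E)
  obtain p' q' where q': "q' \<noteq> 0" "r' = to_fract p' / to_fract q'" "poly_at_0 q' * s' = poly_at_0 p'"
    using assms(2) by (rule has_expansion_at_0E)
  have "r + r' = to_fract (p * q' + p' * q) / to_fract (q * q')"
    using q q' by (simp add: field_simps)
  moreover have "poly_at_0 (q * q') * (s + s') = poly_at_0 (p * q' + p' * q)"
    unfolding poly_at_0_mult poly_at_0_add q(3)[symmetric] q'(3)[symmetric] by (simp add: algebra_simps)
  ultimately show ?thesis using q q' by (simp only: has_expansion_at_0_quotient mult_eq_0_iff simp_thms)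
qed

lemma has_expansion_at_0_mult:
  assumes "has_expansion_at_0 r s" "has_expansion_at_0 r' s'"
  shows "has_expansion_at_0 (r * r') (s * s')"
proof -
  obtain p q where q: "q \<noteq> 0" "r = to_fract p / to_fract q" "poly_at_0 q * s = poly_at_0 p"
    using assms(1) by (rule has_expansion_at_0E)
  obtain p' q' where q': "q' \<noteq> 0" "r' = to_fract p' / to_fract q'" "poly_at_0 q' * s' = poly_at_0 p'"
    using assms(2) by (rule has_expansion_at_0E)
  have "r * r' = to_fract (p * p') / to_fract (q * q')"
    using q q' by simp
  moreover have "poly_at_0 (q * q') * (s * s') = poly_at_0 (p * p')"
    unfolding poly_at_0_mult q(3)[symmetric] q'(3)[symmetric] by (simp add: ac_simps)
  ultimately show ?thesis using q q' by (simp only: has_expansion_at_0_quotient mult_eq_0_iff simp_thms)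
qed

text \<open>The quotient series is given by the product \<open>s' * s'' = s\<close>, so that
  \<open>s'\<close> may be a non-unit such as \<open>fps_X\<close>.\<close>

lemma has_expansion_at_0_divide:
  assumes "has_expansion_at_0 r s" "has_expansion_at_0 r' s'" "r' \<noteq> 0" "s' * s'' = s"
  shows "has_expansion_at_0 (r / r') s''"
proof -
  obtain p q where q: "q \<noteq> 0" "r = to_fract p / to_fract q" "poly_at_0 q * s = poly_at_0 p"
    using assms(1) by (rule has_expansion_at_0E)
  obtain p' q' where q': "q' \<noteq> 0" "r' = to_fract p' / to_fract q'" "poly_at_0 q' * s' = poly_at_0 p'"
    using assms(2) by (rule has_expansion_at_0E)
  have "p' \<noteq> 0" using assms(3) q' by auto
  have "r / r' = to_fract (p * q') / to_fract (q * p')"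
    using q q' by simp
  moreover have "poly_at_0 (q * p') * s'' = poly_at_0 (p * q')"
    unfolding poly_at_0_mult q(3)[symmetric] q'(3)[symmetric] assms(4)[symmetric] by (simp add: ac_simps)
  ultimately show ?thesis using q(1) \<open>p' \<noteq> 0\<close>
    by (simp only: has_expansion_at_0_quotient mult_eq_0_iff simp_thms)
qed

lemma has_expansion_at_0_0: "has_expansion_at_0 0 0"
  using has_expansion_at_0_to_fract[of 0] by simp

lemma has_expansion_at_0_1: "has_expansion_at_0 1 1"
  using has_expansion_at_0_to_fract[of 1] by simp

lemma has_expansion_at_0_minus:
  assumes "has_expansion_at_0 r s"
  shows "has_expansion_at_0 (- r) (- s)"
proof -
  have "poly_at_0 (-1) + poly_at_0 1 = 0"
    unfolding poly_at_0_add[symmetric] by simp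
  then have "poly_at_0 (-1) = -1" by (simp add: eq_neg_iff_add_eq_0)
  with has_expansion_at_0_mult[OF has_expansion_at_0_to_fract[of "-1"] assms]
  show ?thesis by simp
qed

lemma has_expansion_at_0_diff:
  assumes "has_expansion_at_0 r s" "has_expansion_at_0 r' s'"
  shows "has_expansion_at_0 (r - r') (s - s')"
  using has_expansion_at_0_add[OF assms(1) has_expansion_at_0_minus[OF assms(2)]] by simp

lemma has_expansion_at_0_power:
  "has_expansion_at_0 r s \<Longrightarrow> has_expansion_at_0 (r ^ n) (s ^ n)"
  by (induction n) (simp_all add: has_expansion_at_0_1 has_expansion_at_0_mult)

lemma has_expansion_at_0_of_nat: "has_expansion_at_0 (of_nat n) (of_nat n)"
  by (induction n) (simp_all add: has_expansion_at_0_0 has_expansion_at_0_1 has_expansion_at_0_add)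

lemma has_expansion_at_0_sum:
  "(\<And>i. i \<in> A \<Longrightarrow> has_expansion_at_0 (r i) (s i)) \<Longrightarrow> has_expansion_at_0 (\<Sum>i\<in>A. r i) (\<Sum>i\<in>A. s i)"
  by (induction A rule: infinite_finite_induct) (simp_all add: has_expansion_at_0_0 has_expansion_at_0_add)

lemma has_expansion_at_0_x: "has_expansion_at_0 rf_x (fps_const fps_X)"
proof -
  have "poly_at_0 [:[:0, 1:]:] = fps_const fps_X"
    by (rule fps_ext) (simp add: poly_at_0_nth coeff_pCons split: nat.split)
  then show ?thesis using has_expansion_at_0_to_fract[of "[:[:0, 1:]:]"] by (simp add: rf_x_def)
qed

lemma has_expansion_at_0_u: "has_expansion_at_0 rf_u fps_X"
proof -
  have "poly_at_0 [:0, 1:] = fps_X"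
    by (rule fps_ext) (simp add: poly_at_0_nth coeff_pCons fps_X_def split: nat.split)
  then show ?thesis using has_expansion_at_0_to_fract[of "[:0, 1:]"] by (simp add: rf_u_def)
qed

lemmas has_expansion_at_0_intros =
  has_expansion_at_0_0 has_expansion_at_0_1 has_expansion_at_0_x has_expansion_at_0_u
  has_expansion_at_0_of_nat has_expansion_at_0_add has_expansion_at_0_diff has_expansion_at_0_minus
  has_expansion_at_0_mult has_expansion_at_0_power has_expansion_at_0_sum

lemma rf_x_neq [simp]: "rf_x \<noteq> 0" "rf_x \<noteq> 1" "1 - rf_x \<noteq> 0" "rf_x - 1 \<noteq> 0"
proof -
  show "rf_x \<noteq> 0" by (simp add: rf_x_def)
  have "[:[:0, 1:]:] \<noteq> (1 :: rat poly poly)" by (simp add: one_pCons)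
  then show "rf_x \<noteq> 1" unfolding rf_x_def by (metis to_fract_1 to_fract_eq_iff)
  then show "1 - rf_x \<noteq> 0" "rf_x - 1 \<noteq> 0" by simp_all
qed

lemma rf_u_neq [simp]: "rf_u \<noteq> 0" "rf_u \<noteq> 1" "1 - rf_u \<noteq> 0" "rf_u - 1 \<noteq> 0"
proof -
  show "rf_u \<noteq> 0" by (simp add: rf_u_def)
  have "[:0, 1:] \<noteq> (1 :: rat poly poly)" by (simp add: one_pCons)
  then show "rf_u \<noteq> 1" unfolding rf_u_def by (metis to_fract_1 to_fract_eq_iff)
  then show "1 - rf_u \<noteq> 0" "rf_u - 1 \<noteq> 0" by simp_all
qed

section \<open>Expansions of the first and the last expression\<close>

lemma fps_of_nat_mult_nth: "(of_nat n * f) $ k = of_nat n * (f $ k)" for f :: "'a :: comm_ring_1 fps"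
  by (simp flip: fps_of_nat)

lemma fps_signed_nat: "(-1) ^ i * of_nat n = fps_const ((-1) ^ i * of_nat n :: 'a :: comm_ring_1)"
  by (cases "even i") (simp_all add: fps_of_nat flip: fps_const_neg)

lemma fps_sign_mult_nth: "((-1) ^ m * f) $ k = (-1) ^ m * f $ k" for f :: "'a :: comm_ring_1 fps"
  by (cases "even m") simp_all

lemma fps_const_mult_Abs: "fps_const c * Abs_fps f = Abs_fps (\<lambda>n. c * f n)" for c :: "'a :: comm_ring_1"
  by (rule fps_ext) simp

lemma fps_const_sum: "fps_const (sum f A) = (\<Sum>i\<in>A. fps_const (f i))"
  by (rule fps_ext) (simp add: fps_sum_nth)

text \<open>As \<open>x\<close> is the inner variable, a series in \<open>x\<close> alone is a
  constant of the outer series ring.\<close>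

lemma has_expansion_at_0_x_power_divide:
  assumes "d \<le> m"
  shows "has_expansion_at_0 (rf_x ^ (m - d) / (1 - rf_x) ^ (m + 1))
    (fps_const (Abs_fps (\<lambda>n. of_nat ((n + d) choose m))))"
proof (rule has_expansion_at_0_divide)
  show "has_expansion_at_0 (rf_x ^ (m - d)) (fps_const fps_X ^ (m - d))"
    "has_expansion_at_0 ((1 - rf_x) ^ (m + 1)) ((1 - fps_const fps_X) ^ (m + 1))"
    by (intro has_expansion_at_0_intros)+
  have "(1 - fps_const fps_X) ^ (m + 1) = fps_const ((1 - fps_X) ^ (m + 1) :: rat fps)"
    by (simp only: fps_const_power[symmetric] fps_const_sub[symmetric] fps_const_1_eq_1)
  then show "(1 - fps_const fps_X) ^ (m + 1) * fps_const (Abs_fps (\<lambda>n. of_nat ((n + d) choose m))) =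
      fps_const (fps_X :: rat fps) ^ (m - d)"
    using Abs_fps_binomial_mult_power[OF assms, where 'a = rat]
    by (simp only: fps_const_mult fps_const_power mult.commute)
qed simp

lemma has_expansion_at_0_u_power_divide:
  assumes "d \<le> m"
  shows "has_expansion_at_0 (rf_u ^ (m - d) / (1 - rf_u) ^ (m + 1))
    (Abs_fps (\<lambda>n. of_nat ((n + d) choose m)))"
proof (rule has_expansion_at_0_divide)
  show "has_expansion_at_0 (rf_u ^ (m - d)) (fps_X ^ (m - d))"
    "has_expansion_at_0 ((1 - rf_u) ^ (m + 1)) ((1 - fps_X) ^ (m + 1))"
    by (intro has_expansion_at_0_intros)+
qed (use Abs_fps_binomial_mult_power[OF assms, where 'a = "rat fps"] in \<open>simp_all add: mult.commute\<close>)

text \<open>Each summand is a function of \<open>u\<close> times a function of \<open>x\<close>.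
  Comparing coefficients of \<open>u^k * x^n\<close> reduces the claim to the counting identity with
  \<open>J = k + 1\<close> and \<open>l = n + 1\<close>.\<close>

lemma has_expansion_at_0_des_ides_gf:
  "has_expansion_at_0 (des_ides_gf $ m) (double_series m)"
proof -
  let ?P = "{\<pi>. \<pi> permutes {1..m}}"
  \<comment> \<open>With \<open>d = m - des m \<pi>\<close> the numerator
    \<open>rf_u ^ (m - d)\<close> of the earlier lemma becomes the descent power; likewise for
    \<open>B\<close>.\<close>
  define A where "A \<pi> = (Abs_fps (\<lambda>n. of_nat ((n + (m - des m \<pi>)) choose m)) :: rat fps fps)" for \<pi>
  define B where "B \<pi> = (Abs_fps (\<lambda>n. of_nat ((n + (m - ides m \<pi>)) choose m)) :: rat fps)" for \<pi>
  have le: "des m \<pi> \<le> m" "ides m \<pi> \<le> m" for \<pi>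
    using des_le[of m \<pi>] ides_le[of m \<pi>] by simp_all
  have "has_expansion_at_0 (rf_u ^ des m \<pi> * rf_x ^ ides m \<pi> / ((1 - rf_u) ^ (m + 1) * (1 - rf_x) ^ (m + 1)))
      (A \<pi> * fps_const (B \<pi>))" for \<pi>
    using has_expansion_at_0_mult[OF has_expansion_at_0_u_power_divide has_expansion_at_0_x_power_divide,
        of "m - des m \<pi>" m "m - ides m \<pi>" m] le[of \<pi>]
    by (simp add: A_def B_def)
  then have "has_expansion_at_0 (des_ides_gf $ m) (\<Sum>\<pi>\<in>?P. A \<pi> * fps_const (B \<pi>))"
    unfolding des_ides_gf_def fps_nth_Abs_fps by (intro has_expansion_at_0_sum)
  moreover have "(\<Sum>\<pi>\<in>?P. A \<pi> * fps_const (B \<pi>)) = double_series m"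
  proof (intro fps_ext)
    fix k n
    have "(\<Sum>\<pi>\<in>?P. A \<pi> * fps_const (B \<pi>)) $ k $ n =
        of_nat (\<Sum>\<pi>\<in>?P. ((k + (m - des m \<pi>)) choose m) * ((n + (m - ides m \<pi>)) choose m))"
      by (simp add: fps_sum_nth A_def B_def fps_of_nat_mult_nth)
    also have "(\<Sum>\<pi>\<in>?P. ((k + (m - des m \<pi>)) choose m) * ((n + (m - ides m \<pi>)) choose m)) =
        ((Suc k * Suc n + m - 1) choose m)"
      unfolding binomial_mult_eq_sum_permutes[of "Suc k" "Suc n" m] using le by (intro sum.cong) simp_all
    \<comment> \<open>The exponent of \<open>1 / (1 - t)\<close> is \<open>Suc k * Suc n\<close>;
      the lemma on its coefficients takes exponents as successors, hence the
      \<open>- 1\<close>.\<close>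
    also have "of_nat ((Suc k * Suc n + m - 1) choose m) = double_series m $ k $ n"
      using inverse_one_minus_fps_X_power_nth[of "Suc k * Suc n - 1" m, where 'a = rat]
      unfolding double_series_def by simp
    finally show "(\<Sum>\<pi>\<in>?P. A \<pi> * fps_const (B \<pi>)) $ k $ n = double_series m $ k $ n" .
  qed
  ultimately show ?thesis by simp
qed

section \<open>Coefficients of 1 / (1 - x (1-t)^n)\<close>

lemma fps_mult_eq_1_nth:
  fixes a b :: "'a :: comm_ring_1 fps"
  assumes "a * b = 1"
  shows "a $ 0 * b $ k = 1 $ k - (\<Sum>i\<in>{1..k}. a $ i * b $ (k - i))"
proof -
  have "1 $ k = (\<Sum>i=0..k. a $ i * b $ (k - i))"
    unfolding assms[symmetric] fps_mult_nth ..
  also have "\<dots> = a $ 0 * b $ k + (\<Sum>i\<in>{1..k}. a $ i * b $ (k - i))"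
    by (subst sum.atLeast_Suc_atMost) simp_all
  finally show ?thesis by (simp only: add_diff_cancel_right')
qed

lemma has_expansion_at_0_delta: "has_expansion_at_0 (1 $ k) (1 $ k)"
  by (simp add: has_expansion_at_0_0 has_expansion_at_0_1)

text \<open>The coefficients of an inverse satisfy a recursion that uses only ring operations and
  division by the constant coefficient, all of which respect expansions.\<close>

lemma has_expansion_at_0_fps_inverse:
  assumes f: "\<And>k. has_expansion_at_0 (f $ k) (F $ k)"
    and "f * g = 1" "F * H = 1"
  shows "has_expansion_at_0 (g $ k) (H $ k)"
proof (induction k rule: less_induct)
  case (less k)
  have f0: "f $ 0 \<noteq> 0"
    using arg_cong[OF \<open>f * g = 1\<close>, of "\<lambda>c. c $ 0"] by auto
  have "has_expansion_at_0 (1 $ k - (\<Sum>i\<in>{1..k}. f $ i * g $ (k - i)))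
      (1 $ k - (\<Sum>i\<in>{1..k}. F $ i * H $ (k - i)))"
    by (intro has_expansion_at_0_diff has_expansion_at_0_sum has_expansion_at_0_mult
          has_expansion_at_0_delta f less) auto
  from has_expansion_at_0_divide[OF this f f0 fps_mult_eq_1_nth[OF \<open>F * H = 1\<close>]]
  show ?case using f0 unfolding fps_mult_eq_1_nth[OF \<open>f * g = 1\<close>, symmetric] by simp
qed

lemma vandermonde_fps:
  "(\<Sum>i=0..k. (-1) ^ i * of_nat (a choose i) * ((-1) ^ (k - i) * of_nat (b choose (k - i)))) =
    (-1) ^ k * (of_nat ((a + b) choose k) :: 'a :: comm_ring_1)"
proof -
  have "(\<Sum>i=0..k. (-1) ^ i * of_nat (a choose i) * ((-1) ^ (k - i) * of_nat (b choose (k - i)))) =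
      ((1 - fps_X) ^ a * (1 - fps_X) ^ b :: 'a fps) $ k"
    by (simp add: fps_mult_nth one_minus_fps_X_power_nth)
  also have "\<dots> = (-1) ^ k * of_nat ((a + b) choose k)"
    by (simp add: one_minus_fps_X_power_nth flip: power_add)
  finally show ?thesis .
qed

text \<open>The constant coefficient \<open>1 - x\<close> is nonzero, so this is a true inverse, to
  be thought of as the sum of \<open>x^l * (1 - t)^(n * l)\<close> over \<open>l\<close>.\<close>

definition geom_gf :: "nat \<Rightarrow> ratfun fps" where
  "geom_gf n = inverse (1 - fps_const rf_x * (1 - fps_X) ^ n)"

text \<open>The geometric series in \<open>x\<close> suggests the coefficients. The proof avoids the
  infinite sum by checking that the candidate \<open>H\<close> is inverse to the expanded
  denominator \<open>F\<close>.\<close>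

lemma has_expansion_at_0_geom_gf:
  "has_expansion_at_0 (geom_gf n $ m) (fps_const (Abs_fps (\<lambda>l. (-1) ^ m * of_nat ((n * l) choose m))))"
proof -
  define f where "f = (1 - fps_const rf_x * (1 - fps_X) ^ n :: ratfun fps)"
  define F where "F = (1 - fps_const (fps_const fps_X) * (1 - fps_X) ^ n :: rat fps fps fps)"
  \<comment> \<open>\<open>h a\<close> collects the coefficients in \<open>t\<close> of
    \<open>(1 - t)^a\<close> times the geometric series: \<open>a = 0\<close> gives the candidate,
    and \<open>a = n\<close> appears on multiplying it by \<open>(1 - t)^n\<close>.\<close>
  define h where "h a m = (fps_const (Abs_fps (\<lambda>l. (-1) ^ m * of_nat ((a + n * l) choose m))) :: rat fps fps)" for a m
  define H where "H = Abs_fps (h 0)"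
  have "has_expansion_at_0 (f $ k) (F $ k)" for k
  proof -
    have "has_expansion_at_0 (1 $ k - rf_x * ((-1) ^ k * of_nat (n choose k)))
        (1 $ k - fps_const fps_X * ((-1) ^ k * of_nat (n choose k)))"
      by (intro has_expansion_at_0_intros has_expansion_at_0_delta)
    then show ?thesis unfolding f_def F_def by (simp only: fps_sub_nth fps_mult_left_const_nth one_minus_fps_X_power_nth)
  qed
  moreover have "f $ 0 \<noteq> 0" by (simp add: f_def fps_power_zeroth)
  then have "f * geom_gf n = 1" unfolding geom_gf_def f_def by (rule inverse_mult_eq_1')
  moreover have "F * H = 1"
  proof (rule fps_ext)
    fix k
    have "((1 - fps_X) ^ n * H) $ k = h n k"
    proof -
      have "((1 - fps_X) ^ n * H) $ k = fps_const (\<Sum>i=0..k. Abs_fps (\<lambda>l.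
          (-1) ^ i * of_nat (n choose i) * ((-1) ^ (k - i) * of_nat ((n * l) choose (k - i)))))"
        unfolding fps_mult_nth one_minus_fps_X_power_nth fps_const_sum H_def h_def
        by (simp only: fps_nth_Abs_fps fps_signed_nat fps_const_mult add_0 fps_const_mult_Abs)
      also have "\<dots> = h n k"
        unfolding h_def vandermonde_fps[symmetric] by (intro arg_cong[of _ _ fps_const] fps_ext) (simp add: fps_sum_nth)
      finally show ?thesis .
    qed
    then have "(F * H) $ k = h 0 k - fps_const fps_X * h n k"
      unfolding F_def by (simp add: left_diff_distrib mult.assoc H_def)
    also have "\<dots> = fps_const (Abs_fps (\<lambda>l. (-1) ^ k * of_nat ((n * l) choose k)) -
        fps_X * Abs_fps (\<lambda>l. (-1) ^ k * of_nat ((n + n * l) choose k)))"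
      unfolding h_def by (simp only: fps_const_mult fps_const_sub add_0)
    \<comment> \<open>Multiplication by \<open>x\<close> shifts \<open>l\<close> to
      \<open>l - 1\<close>, and \<open>n + n * (l - 1) = n * l\<close>; so all cancels except at
      \<open>l = 0\<close>, which leaves \<open>0 choose k\<close>.\<close>
    also have "\<dots> = fps_const (if k = 0 then 1 else 0)"
    proof (rule arg_cong[of _ _ fps_const], rule fps_ext)
      fix l
      show "(Abs_fps (\<lambda>l. (-1) ^ k * of_nat ((n * l) choose k)) -
          fps_X * Abs_fps (\<lambda>l. (-1) ^ k * of_nat ((n + n * l) choose k))) $ l =
        ((if k = 0 then 1 else 0) :: rat fps) $ l"
        by (cases l) (auto simp: binomial_eq_0)
    qed
    finally show "(F * H) $ k = 1 $ k" by simp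
  qed
  ultimately have "has_expansion_at_0 (geom_gf n $ m) (H $ m)"
    by (rule has_expansion_at_0_fps_inverse)
  then show ?thesis by (simp add: H_def h_def)
qed

text \<open>Both sides have the same expansion: at \<open>x^l\<close> this is the counting identity
  evaluated at \<open>-n\<close>. The numerator exponent arises as
  \<open>m - (m - 1 - ides m \<pi>)\<close>.\<close>

lemma geom_gf_nth:
  assumes "m \<ge> 1"
  shows "geom_gf n $ m = (-1) ^ m * (\<Sum>\<pi> | \<pi> permutes {1..m}.
    of_nat ((n + des m \<pi>) choose m) * (rf_x ^ (ides m \<pi> + 1) / (1 - rf_x) ^ (m + 1)))" (is "_ = ?r")
proof (rule has_expansion_at_0_unique[OF has_expansion_at_0_geom_gf])
  let ?P = "{\<pi>. \<pi> permutes {1..m}}"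
  define B where "B \<pi> = (Abs_fps (\<lambda>l. of_nat ((l + (m - 1 - ides m \<pi>)) choose m)) :: rat fps)" for \<pi>
  have "has_expansion_at_0 (rf_x ^ (ides m \<pi> + 1) / (1 - rf_x) ^ (m + 1)) (fps_const (B \<pi>))" for \<pi>
    using has_expansion_at_0_x_power_divide[of "m - 1 - ides m \<pi>" m] ides_le[of m \<pi>] assms
    by (simp add: B_def)
  then have "has_expansion_at_0 ?r ((-1) ^ m * (\<Sum>\<pi>\<in>?P. of_nat ((n + des m \<pi>) choose m) * fps_const (B \<pi>)))"
    by (intro has_expansion_at_0_intros)
  also have "(-1) ^ m * (\<Sum>\<pi>\<in>?P. of_nat ((n + des m \<pi>) choose m) * fps_const (B \<pi>)) =
      fps_const ((-1) ^ m * (\<Sum>\<pi>\<in>?P. of_nat ((n + des m \<pi>) choose m) * B \<pi>))"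
    using fps_signed_nat[of m 1, where 'a = "rat fps"]
    by (simp add: fps_const_sum fps_of_nat flip: fps_const_mult)
  also have "(-1) ^ m * (\<Sum>\<pi>\<in>?P. of_nat ((n + des m \<pi>) choose m) * B \<pi>) =
      Abs_fps (\<lambda>l. (-1) ^ m * of_nat ((n * l) choose m))"
  proof (rule fps_ext)
    fix l
    have "(n * l) choose m = (\<Sum>\<pi>\<in>?P. ((n + des m \<pi>) choose m) * ((l + (m - 1 - ides m \<pi>)) choose m))"
    proof -
      have "l + m - 1 - ides m \<pi> = l + (m - 1 - ides m \<pi>)" for \<pi>
        using assms ides_le[of m \<pi>] by simp
      then show ?thesis by (simp only: binomial_mult_eq_sum_permutes'[OF assms, of n l])
    qed
    then show "((-1) ^ m * (\<Sum>\<pi>\<in>?P. of_nat ((n + des m \<pi>) choose m) * B \<pi>)) $ l =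
        Abs_fps (\<lambda>l. (-1) ^ m * of_nat ((n * l) choose m)) $ l"
      by (simp add: fps_sign_mult_nth fps_sum_nth B_def fps_of_nat_mult_nth)
  qed
  finally show "has_expansion_at_0 ?r (fps_const (Abs_fps (\<lambda>l. (-1) ^ m * of_nat ((n * l) choose m))))" .
qed

section \<open>Expansion in powers of 1/u\<close>

notation fls_nth (infixl "$$" 75)

lemma poly_at_inf_0 [simp]: "poly_at_inf 0 = 0"
  by (simp add: poly_at_inf_def)

lemma poly_at_inf_pCons:
  "poly_at_inf (pCons a p) = fls_const (to_fract a) + fls_X_inv * poly_at_inf p"
  by (simp add: poly_at_inf_def map_poly_pCons)

lemma poly_at_inf_1 [simp]: "poly_at_inf 1 = 1"
  using poly_at_inf_pCons[of 1 0] by (simp add: pCons_one)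

lemma poly_at_inf_add: "poly_at_inf (p + q) = poly_at_inf p + poly_at_inf q"
  by (induction p q rule: poly_induct2) (simp_all add: poly_at_inf_pCons algebra_simps flip: fls_plus_const)

lemma poly_at_inf_smult: "poly_at_inf (smult c p) = fls_const (to_fract c) * poly_at_inf p"
  by (induction p) (simp_all add: poly_at_inf_pCons algebra_simps flip: fls_const_mult_const)

lemma poly_at_inf_mult: "poly_at_inf (p * q) = poly_at_inf p * poly_at_inf q"
  by (induction p) (simp_all add: poly_at_inf_pCons poly_at_inf_add poly_at_inf_smult algebra_simps)

lemma poly_at_inf_nth: "poly_at_inf p $$ k = (if k \<le> 0 then to_fract (coeff p (nat (- k))) else 0)"
proof (induction p arbitrary: k)
  case (pCons a p)
  have "nat (- k) = Suc (nat (- (k + 1)))" if "k < 0" using that by simp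
  then show ?case
    using pCons.IH[of "k + 1"] by (cases "k = 0") (auto simp: poly_at_inf_pCons fls_X_inv_times_conv_shift)
qed simp

lemma poly_at_inf_eq_0_iff [simp]: "poly_at_inf p = 0 \<longleftrightarrow> p = 0"
proof
  assume "poly_at_inf p = 0"
  then have "to_fract (coeff p n) = 0" for n
    using poly_at_inf_nth[of p "- int n"] by simp
  then show "p = 0" by (simp add: poly_eq_iff)
qed simp

text \<open>Again any representing fraction may be used, as \<open>poly_at_inf\<close> is an
  injective ring homomorphism. Consequently \<open>expand_at_inf\<close> is a field
  embedding.\<close>

lemma expand_at_inf_quotient:
  assumes "q \<noteq> 0"
  shows "expand_at_inf (to_fract p / to_fract q) = poly_at_inf p / poly_at_inf q"
proof -
  define r where "r = to_fract p / to_fract q"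
  define a where "a = fst (quot_of_fract r)"
  define b where "b = snd (quot_of_fract r)"
  have b: "b \<noteq> 0" unfolding b_def by simp
  have "to_fract a / to_fract b = to_fract p / to_fract q"
    using Fract_quot_of_fract[of r] unfolding a_def b_def r_def Fract_conv_to_fract .
  then have "to_fract (a * q) = to_fract (p * b)"
    using b assms by (simp add: field_simps)
  then have "poly_at_inf (a * q) = poly_at_inf (p * b)" by (simp only: to_fract_eq_iff)
  then have "poly_at_inf a / poly_at_inf b = poly_at_inf p / poly_at_inf q"
    using b assms by (simp add: frac_eq_eq poly_at_inf_mult)
  then show ?thesis unfolding expand_at_inf_def a_def b_def r_def .
qed

lemma ratfunE:
  obtains p q where "q \<noteq> 0" "(r :: ratfun) = to_fract p / to_fract q"
proof
  show "snd (quot_of_fract r) \<noteq> 0" by simp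
  show "r = to_fract (fst (quot_of_fract r)) / to_fract (snd (quot_of_fract r))"
    using Fract_quot_of_fract[of r] unfolding Fract_conv_to_fract by simp
qed

lemma expand_at_inf_to_fract: "expand_at_inf (to_fract p) = poly_at_inf p"
  using expand_at_inf_quotient[of 1 p] by simp

lemma expand_at_inf_add: "expand_at_inf (r + r') = expand_at_inf r + expand_at_inf r'"
proof -
  obtain p q where q: "q \<noteq> 0" "r = to_fract p / to_fract q" by (rule ratfunE)
  obtain p' q' where q': "q' \<noteq> 0" "r' = to_fract p' / to_fract q'" by (rule ratfunE)
  have "r + r' = to_fract (p * q' + p' * q) / to_fract (q * q')"
    using q q' by (simp add: add_frac_eq)
  then have "expand_at_inf (r + r') = poly_at_inf (p * q' + p' * q) / poly_at_inf (q * q')"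
    using q q' by (simp only: expand_at_inf_quotient mult_eq_0_iff simp_thms)
  also have "\<dots> = poly_at_inf p / poly_at_inf q + poly_at_inf p' / poly_at_inf q'"
    using q q' by (simp add: add_frac_eq poly_at_inf_add poly_at_inf_mult)
  finally show ?thesis unfolding q(2) q'(2) expand_at_inf_quotient[OF q(1)] expand_at_inf_quotient[OF q'(1)] .
qed

lemma expand_at_inf_mult: "expand_at_inf (r * r') = expand_at_inf r * expand_at_inf r'"
proof -
  obtain p q where q: "q \<noteq> 0" "r = to_fract p / to_fract q" by (rule ratfunE)
  obtain p' q' where q': "q' \<noteq> 0" "r' = to_fract p' / to_fract q'" by (rule ratfunE)
  have "r * r' = to_fract (p * p') / to_fract (q * q')" using q q' by simp
  then have "expand_at_inf (r * r') = poly_at_inf (p * p') / poly_at_inf (q * q')"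
    using q q' by (simp only: expand_at_inf_quotient mult_eq_0_iff simp_thms)
  then show ?thesis using q q' by (simp add: expand_at_inf_quotient poly_at_inf_mult)
qed

lemma expand_at_inf_0 [simp]: "expand_at_inf 0 = 0"
  using expand_at_inf_to_fract[of 0] by simp

lemma expand_at_inf_1 [simp]: "expand_at_inf 1 = 1"
  using expand_at_inf_to_fract[of 1] by simp

lemma expand_at_inf_eq_0_iff: "expand_at_inf r = 0 \<longleftrightarrow> r = 0"
proof -
  obtain p q where "q \<noteq> 0" "r = to_fract p / to_fract q" by (rule ratfunE)
  then show ?thesis by (simp add: expand_at_inf_quotient)
qed

lemma expand_at_inf_minus: "expand_at_inf (- r) = - expand_at_inf r"
  using expand_at_inf_add[of r "- r"] by (simp add: eq_neg_iff_add_eq_0 add.commute)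

lemma expand_at_inf_diff: "expand_at_inf (r - r') = expand_at_inf r - expand_at_inf r'"
  using expand_at_inf_add[of r "- r'"] by (simp add: expand_at_inf_minus)

lemma expand_at_inf_eq_iff: "expand_at_inf r = expand_at_inf r' \<longleftrightarrow> r = r'"
  using expand_at_inf_eq_0_iff[of "r - r'"] by (simp add: expand_at_inf_diff)

lemma expand_at_inf_divide: "expand_at_inf (r / r') = expand_at_inf r / expand_at_inf r'"
proof (cases "r' = 0")
  case False
  then have "expand_at_inf (r / r') * expand_at_inf r' = expand_at_inf r"
    by (simp flip: expand_at_inf_mult)
  with False show ?thesis by (simp add: expand_at_inf_eq_0_iff eq_divide_eq)
qed simp

lemma expand_at_inf_power: "expand_at_inf (r ^ n) = expand_at_inf r ^ n"
  by (induction n) (simp_all add: expand_at_inf_mult)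

lemma expand_at_inf_of_nat: "expand_at_inf (of_nat n) = of_nat n"
  by (induction n) (simp_all add: expand_at_inf_add)

lemma expand_at_inf_sum: "expand_at_inf (\<Sum>i\<in>A. f i) = (\<Sum>i\<in>A. expand_at_inf (f i))"
  by (induction A rule: infinite_finite_induct) (simp_all add: expand_at_inf_add)

lemma expand_at_inf_u: "expand_at_inf rf_u = fls_X_inv"
  by (simp add: rf_u_def expand_at_inf_to_fract poly_at_inf_pCons)

lemma expand_at_inf_x: "expand_at_inf rf_x = fls_const (to_fract [:0, 1:])"
  by (simp add: rf_x_def expand_at_inf_to_fract poly_at_inf_pCons)

lemmas expand_at_inf_simps =
  expand_at_inf_add expand_at_inf_diff expand_at_inf_minus expand_at_inf_mult expand_at_inf_divide
  expand_at_inf_power expand_at_inf_of_nat expand_at_inf_sum expand_at_inf_u expand_at_inf_x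

text \<open>The distance of two distinct series is 2 to minus the order of their difference, so
  vanishing below degree \<open>N\<close> bounds it by \<open>(1 / 2) ^ N\<close>.\<close>

lemma fls_sumsI:
  fixes f :: "nat \<Rightarrow> 'a :: ab_group_add fls"
  assumes "\<And>N k. k < int N \<Longrightarrow> (s - (\<Sum>n<N. f n)) $$ k = 0"
  shows "f sums s"
  unfolding sums_def
proof (rule metric_LIMSEQ_I)
  fix e :: real assume "e > 0"
  then obtain M where M: "(1 / 2) ^ M < e"
    using real_arch_pow_inv[of e "1 / 2"] by auto
  have "dist (\<Sum>n<N. f n) s < e" if "N \<ge> M" for N
  proof (cases "(\<Sum>n<N. f n) = s")
    case False
    let ?d = "fls_subdegree ((\<Sum>n<N. f n) - s)"
    have "int N \<le> ?d"
    proof (rule fls_subdegree_geI)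
      show "((\<Sum>n<N. f n) - s) $$ k = 0" if "k < int N" for k
        using assms[OF that] by simp
    qed (use False in simp)
    then have "M \<le> nat ?d" and "dist (\<Sum>n<N. f n) s = (1 / 2) ^ nat ?d"
      using that False by (simp_all add: dist_fls_def power_one_over inverse_eq_divide)
    then have "dist (\<Sum>n<N. f n) s \<le> (1 / 2) ^ M"
      by (simp only:) (rule power_decreasing, simp_all)
    with M show ?thesis by simp
  qed (use \<open>e > 0\<close> in simp)
  then show "\<exists>M. \<forall>N\<ge>M. dist (\<Sum>n<N. f n) s < e" by blast
qed

section \<open>Summation of the middle expression\<close>

lemma rf_sums_unique:
  assumes "rf_sums f r" "rf_sums f r'"
  shows "r = r'"
  using sums_unique2[of _ "expand_at_inf r" "expand_at_inf r'"] assms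
  unfolding rf_sums_def expand_at_inf_eq_iff by blast

text \<open>The numerator telescopes because \<open>x t (1-t)^n = (1 - x (1-t)^(n+1)) - (1 - x (1-t)^n)\<close>.\<close>

lemma middle_term_eq_diff:
  "fps_const (rf_x * (rf_u - 1) * rf_u ^ (n + 1)) * middle_term (n + 1) = geom_gf n - geom_gf (n + 1)"
proof -
  define D where "D k = (1 - fps_const rf_x * (1 - fps_X) ^ k :: ratfun fps)" for k
  define U where "U = fps_const (rf_u ^ (n + 1))"
  define den where "den = U * D n * D (n + 1)"
  have D0: "D k $ 0 \<noteq> 0" for k by (simp add: D_def fps_power_zeroth)
  then have D: "D k * geom_gf k = 1" for k
    unfolding geom_gf_def D_def by (rule inverse_mult_eq_1')
  have den0: "den $ 0 \<noteq> 0" using D0 by (simp add: den_def U_def)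
  have "middle_term (n + 1) * den = fps_X * (1 - fps_X) ^ n * fps_const (inverse (rf_u - 1))"
  proof -
    have "middle_term (n + 1) = fps_X * (1 - fps_X) ^ n * fps_const (inverse (rf_u - 1)) / den"
      unfolding middle_term_def den_def U_def D_def by simp
    with den0 show ?thesis by (simp add: fps_divide_unit mult.assoc inverse_mult_eq_1)
  qed
  then have "fps_const (rf_x * (rf_u - 1) * rf_u ^ (n + 1)) * middle_term (n + 1) * den =
      fps_const (rf_x * (rf_u - 1) * rf_u ^ (n + 1)) * fps_const (inverse (rf_u - 1)) * (fps_X * (1 - fps_X) ^ n)"
    by (simp only: mult.assoc) (simp only: ac_simps)
  also have "fps_const (rf_x * (rf_u - 1) * rf_u ^ (n + 1)) * fps_const (inverse (rf_u - 1)) =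
      fps_const rf_x * U"
    by (simp add: U_def field_simps)
  also have "fps_const rf_x * U * (fps_X * (1 - fps_X) ^ n) = U * (D (n + 1) - D n)"
    by (simp add: D_def algebra_simps)
  also have "\<dots> = (geom_gf n - geom_gf (n + 1)) * den"
  proof -
    have "(geom_gf n - geom_gf (n + 1)) * den =
        U * (D (n + 1) * (D n * geom_gf n) - D n * (D (n + 1) * geom_gf (n + 1)))"
      unfolding den_def by (simp only: algebra_simps)
    then show ?thesis by (simp only: D mult_1_right)
  qed
  finally show ?thesis using den0 by auto
qed

text \<open>By telescoping, the coefficient comes from a difference of consecutive values in
  \<open>n\<close>. Pascal's rule lowers the lower index to \<open>m - 1\<close>, the order of the
  difference flips the sign, and the extra factor \<open>x\<close> of \<open>geom_gf_nth\<close>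
  cancels.\<close>

lemma middle_term_nth:
  assumes "m \<ge> 1"
  shows "middle_term (n + 1) $ m = (-1) ^ (m + 1) * (\<Sum>\<pi> | \<pi> permutes {1..m}.
    of_nat ((n + des m \<pi>) choose (m - 1)) / (rf_u ^ (n + 1) * (rf_u - 1)) *
      (rf_x ^ ides m \<pi> / (1 - rf_x) ^ (m + 1)))"
proof -
  let ?P = "{\<pi>. \<pi> permutes {1..m}}"
  define w where "w \<pi> = rf_x ^ ides m \<pi> / (1 - rf_x) ^ (m + 1)" for \<pi>
  define c where "c = rf_x * (rf_u - 1) * rf_u ^ (n + 1)"
  have c: "c \<noteq> 0" by (simp add: c_def)
  have pascal: "(of_nat ((n + 1 + d) choose m) :: ratfun) =
      of_nat ((n + d) choose (m - 1)) + of_nat ((n + d) choose m)" for d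
    using assms by (cases m) simp_all
  have g: "geom_gf k $ m = (-1) ^ m * (\<Sum>\<pi>\<in>?P. of_nat ((k + des m \<pi>) choose m) * (rf_x * w \<pi>))" for k
    unfolding geom_gf_nth[OF assms] w_def by simp
  have "c * middle_term (n + 1) $ m = geom_gf n $ m - geom_gf (n + 1) $ m"
    using arg_cong[OF middle_term_eq_diff[of n], of "\<lambda>f. f $ m"] by (simp add: c_def)
  also have "\<dots> = (-1) ^ (m + 1) * (\<Sum>\<pi>\<in>?P. of_nat ((n + des m \<pi>) choose (m - 1)) * (rf_x * w \<pi>))"
    unfolding g pascal by (simp add: algebra_simps sum.distrib)
  also have "\<dots> = c * ((-1) ^ (m + 1) * (\<Sum>\<pi>\<in>?P. of_nat ((n + des m \<pi>) choose (m - 1)) /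
      (rf_u ^ (n + 1) * (rf_u - 1)) * w \<pi>))"
  proof -
    have "of_nat k * (rf_x * w \<pi>) = c * (of_nat k / (rf_u ^ (n + 1) * (rf_u - 1)) * w \<pi>)" for k \<pi>
      by (simp add: c_def field_simps)
    then show ?thesis unfolding sum_distrib_left by (simp only: mult.left_commute)
  qed
  finally show ?thesis unfolding mult_left_cancel[OF c] w_def .
qed

text \<open>With \<open>y\<close> for \<open>1/u\<close>, the descent factor of the first expression
  is written with the factor \<open>y^2 / (1 - y)\<close> that the terms of the middle sum have
  too.\<close>

lemma inverse_power_divide_one_minus_inverse:
  fixes y :: "'a :: field"
  assumes "y \<noteq> 0" "1 - y \<noteq> 0" "m \<ge> 1" "d \<le> m - 1"
  shows "inverse y ^ d / (1 - inverse y) ^ (m + 1) =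
    (-1) ^ (m + 1) * (y ^ 2 * (1 / (1 - y)) * (y ^ (m - 1 - d) / (1 - y) ^ m))"
proof -
  \<comment> \<open>Here \<open>e\<close> is \<open>m - 1 - d\<close>, freed from natural
    subtraction.\<close>
  obtain e where e: "m = d + e + 1" using assms(3,4) by (metis Suc_eq_plus1 le_add_diff_inverse le_add_diff_inverse2)
  have "1 - inverse y = (- (1 - y)) / y" using assms(1) by (simp add: field_simps)
  then have "inverse y ^ d / (1 - inverse y) ^ (m + 1) = inverse y ^ d / ((- (1 - y)) ^ (m + 1) / y ^ (m + 1))"
    by (simp only: power_divide)
  also have "\<dots> = (y ^ (m + 1) / y ^ d) / (- (1 - y)) ^ (m + 1)"
    by (simp add: power_inverse divide_inverse mult.commute)
  also have "y ^ (m + 1) / y ^ d = y ^ 2 * y ^ (m - 1 - d)"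
    using assms(1) by (simp add: e power_add power2_eq_square)
  also have "(- (1 - y)) ^ (m + 1) = (-1) ^ (m + 1) * ((1 - y) * (1 - y) ^ m)"
    by (subst power_minus) simp
  also have "y ^ 2 * y ^ (m - 1 - d) / ((-1) ^ (m + 1) * ((1 - y) * (1 - y) ^ m)) =
      (-1) ^ (m + 1) * (y ^ 2 * (1 / (1 - y)) * (y ^ (m - 1 - d) / (1 - y) ^ m))"
    by (cases "even m") simp_all
  finally show ?thesis .
qed

lemma divide_inverse_power_inverse_minus_one:
  fixes y :: "'a :: field"
  assumes "y \<noteq> 0" "1 - y \<noteq> 0"
  shows "c / (inverse y ^ (n + 1) * (inverse y - 1)) = y ^ 2 * (1 / (1 - y)) * (c * y ^ n)"
proof -
  have "inverse y - 1 = (1 - y) / y" using assms(1) by (simp add: field_simps)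
  then show ?thesis using assms by (simp add: power_inverse divide_inverse power2_eq_square)
qed

text \<open>Without the common sign and factor, \<open>s\<close> is
  \<open>y^(m-1-d) / (1-y)^m\<close> with \<open>y = 1/u\<close>, and the \<open>a n\<close> are the
  terms of its power series. The partial sum thus leaves a tail starting at
  \<open>y^N\<close>.\<close>

lemma sum_binomial_at_inf_remainder:
  fixes m d N :: nat
  assumes "m \<ge> 1" "d \<le> m - 1"
  defines "s \<equiv> fls_X_inv ^ d / (1 - fls_X_inv) ^ (m + 1) :: 'a :: field_char_0 fls"
    and "a \<equiv> \<lambda>n. (-1) ^ (m + 1) * (of_nat ((n + d) choose (m - 1)) / (fls_X_inv ^ (n + 1) * (fls_X_inv - 1)))"
  assumes "k < int N"
  shows "(s - (\<Sum>n<N. a n)) $$ k = 0"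
proof -
  \<comment> \<open>\<open>A\<close> is the full series in \<open>y\<close>, \<open>R\<close> its
    tail from order \<open>N\<close> on, and \<open>Z\<close> the series of
    \<open>1 / (1 - y)\<close>. All are power series, so the coefficients of negative degree vanish
    too.\<close>
  define A where "A = (Abs_fps (\<lambda>n. of_nat ((n + d) choose (m - 1))) :: 'a fps)"
  define R where "R = A - (\<Sum>n<N. of_nat ((n + d) choose (m - 1)) * fps_X ^ n)"
  define Z where "Z = inverse (1 - fps_X :: 'a fps)"
  have X: "fls_X_inv = (inverse fls_X :: 'a fls)" by (simp add: fls_inverse_X)
  have X1: "1 - fls_X \<noteq> (0 :: 'a fls)"
    by (metis eq_iff_diff_eq_0 fls_X_subdegree fls_one_subdegree zero_neq_one)
  have "Z * (1 - fps_X) = 1"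
    unfolding Z_def by (rule inverse_mult_eq_1) simp
  from arg_cong[OF this, of fps_to_fls] have Z: "fps_to_fls Z = 1 / (1 - fls_X)"
    using X1 by (simp add: fls_times_fps_to_fls field_simps)
  have A: "fps_to_fls A = fls_X ^ (m - 1 - d) / (1 - fls_X) ^ m"
  proof -
    have "A * (1 - fps_X) ^ m = fps_X ^ (m - 1 - d)"
      using Abs_fps_binomial_mult_power[OF assms(2), where 'a = 'a] assms(1) by (simp add: A_def)
    from arg_cong[OF this, of fps_to_fls] show ?thesis
      using X1 by (simp add: fls_times_fps_to_fls fps_to_fls_power field_simps)
  qed
  have s: "s = (-1) ^ (m + 1) * (fls_X ^ 2 * fps_to_fls Z * fps_to_fls A)"
    unfolding s_def X Z A using inverse_power_divide_one_minus_inverse[OF _ X1 assms(1,2)] by simp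
  have a: "a n = (-1) ^ (m + 1) * (fls_X ^ 2 * fps_to_fls Z * (of_nat ((n + d) choose (m - 1)) * fls_X ^ n))" for n
    unfolding a_def X Z using divide_inverse_power_inverse_minus_one[OF _ X1] by simp
  have "s - (\<Sum>n<N. a n) = (-1) ^ (m + 1) * (fls_X ^ 2 * fps_to_fls Z *
      (fps_to_fls A - (\<Sum>n<N. of_nat ((n + d) choose (m - 1)) * fls_X ^ n)))"
    unfolding s a by (simp only: sum_distrib_left right_diff_distrib)
  also have "(\<Sum>n<N. of_nat ((n + d) choose (m - 1)) * fls_X ^ n) =
      fps_to_fls (\<Sum>n<N. of_nat ((n + d) choose (m - 1)) * fps_X ^ n)"
  proof (induction N)
    case (Suc N)
    then show ?case
      by (simp only: sum.lessThan_Suc fps_to_fls_plus fls_times_fps_to_fls fps_to_fls_power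
            fps_to_fls_of_nat fps_X_to_fls)
  qed simp
  also have "(-1) ^ (m + 1) * (fls_X ^ 2 * fps_to_fls Z * (fps_to_fls A -
        fps_to_fls (\<Sum>n<N. of_nat ((n + d) choose (m - 1)) * fps_X ^ n))) =
      fps_to_fls ((-1) ^ (m + 1) * (fps_X ^ 2 * Z) * R)"
    by (simp only: R_def fls_times_fps_to_fls fps_to_fls_power fps_X_to_fls fps_to_fls_minus
          fps_to_fls_uminus fps_one_to_fls mult.assoc)
  finally have eq: "s - (\<Sum>n<N. a n) = fps_to_fls ((-1) ^ (m + 1) * (fps_X ^ 2 * Z) * R)" .
  have R0: "R $ j = 0" if "j < N" for j
  proof -
    have "(\<Sum>n<N. of_nat ((n + d) choose (m - 1)) * fps_X ^ n) $ j =
        (\<Sum>n<N. if j = n then of_nat ((n + d) choose (m - 1)) else (0 :: 'a))"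
      unfolding fps_sum_nth by (intro sum.cong) (simp_all add: fps_of_nat_mult_nth fps_X_power_iff)
    with that show ?thesis by (simp add: R_def A_def)
  qed
  show ?thesis
  proof (cases "k < 0")
    case False
    then have "nat k < N" using assms(5) by simp
    then have "(B * R) $ nat k = 0" for B
      unfolding fps_mult_nth using R0 by (intro sum.neutral) simp
    then show ?thesis unfolding eq fps_to_fls_nth by simp
  qed (simp add: eq)
qed

text \<open>In degree 0 all terms vanish, as each has a factor \<open>t\<close>; the extra constant
  in \<open>middle_gf\<close> accounts for that degree. In positive degree the finite sum over
  \<open>\<pi>\<close> is exchanged with the sum over \<open>n\<close>, and each permutation is
  treated separately.\<close>

lemma rf_sums_middle_term:
  "rf_sums (\<lambda>n. middle_term (n + 1) $ m) (if m = 0 then 0 else des_ides_gf $ m)"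
proof (cases "m = 0")
  case True
  have "middle_term (n + 1) $ 0 = 0" for n
  proof -
    have "rf_x * (rf_u - 1) * rf_u ^ (n + 1) * middle_term (n + 1) $ 0 = geom_gf n $ 0 - geom_gf (n + 1) $ 0"
      using arg_cong[OF middle_term_eq_diff[of n], of "\<lambda>f. f $ 0"] by simp
    also have "\<dots> = 0" by (simp add: geom_gf_def fps_power_zeroth)
    finally show ?thesis by simp
  qed
  with True show ?thesis by (simp add: rf_sums_def)
next
  case False
  then have m: "m \<ge> 1" by simp
  let ?P = "{\<pi>. \<pi> permutes {1..m}}"
  define \<xi> where "\<xi> = (to_fract [:0, 1:] :: rat poly fract)"
  define w where "w \<pi> = \<xi> ^ ides m \<pi> / (1 - \<xi>) ^ (m + 1)" for \<pi>
  define a where "a d n = ((-1) ^ (m + 1) * (of_nat ((n + d) choose (m - 1)) /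
    (fls_X_inv ^ (n + 1) * (fls_X_inv - 1))) :: rat poly fract fls)" for d n
  define s where "s d = (fls_X_inv ^ d / (1 - fls_X_inv) ^ (m + 1) :: rat poly fract fls)" for d
  \<comment> \<open>\<open>x\<close> is a scalar for Laurent series in \<open>1/u\<close>, so the
    factor depending on \<open>x\<close> passes through as a constant.\<close>
  have w: "expand_at_inf (rf_x ^ ides m \<pi> / (1 - rf_x) ^ (m + 1)) = fls_const (w \<pi>)" for \<pi>
  proof -
    have "1 - fls_const \<xi> = fls_const (1 - \<xi>)"
      using fls_minus_const[of 1 \<xi>] by simp
    then show ?thesis
      unfolding w_def expand_at_inf_simps expand_at_inf_1
      by (simp only: \<xi>_def fls_const_divide_const fls_const_power[symmetric])
  qed
  have expand_term: "expand_at_inf (middle_term (n + 1) $ m) = (\<Sum>\<pi>\<in>?P. a (des m \<pi>) n * fls_const (w \<pi>))" for n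
  proof -
    have "expand_at_inf (middle_term (n + 1) $ m) = (-1) ^ (m + 1) * (\<Sum>\<pi>\<in>?P.
        of_nat ((n + des m \<pi>) choose (m - 1)) / (fls_X_inv ^ (n + 1) * (fls_X_inv - 1)) * fls_const (w \<pi>))"
      unfolding middle_term_nth[OF m] w[symmetric] by (simp only: expand_at_inf_simps expand_at_inf_1)
    then show ?thesis
      unfolding a_def by (simp only: sum_distrib_left mult.assoc)
  qed
  have total: "expand_at_inf (des_ides_gf $ m) = (\<Sum>\<pi>\<in>?P. s (des m \<pi>) * fls_const (w \<pi>))"
  proof -
    have "des_ides_gf $ m = (\<Sum>\<pi>\<in>?P. rf_u ^ des m \<pi> / (1 - rf_u) ^ (m + 1) *
        (rf_x ^ ides m \<pi> / (1 - rf_x) ^ (m + 1)))"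
      by (simp add: des_ides_gf_def)
    then show ?thesis
      unfolding s_def w[symmetric] by (simp only: expand_at_inf_simps expand_at_inf_1)
  qed
  have "(\<lambda>n. expand_at_inf (middle_term (n + 1) $ m)) sums expand_at_inf (des_ides_gf $ m)"
  proof (rule fls_sumsI)
    fix N k assume k: "k < int N"
    have zero: "(s (des m \<pi>) - (\<Sum>n<N. a (des m \<pi>) n)) $$ k = 0" for \<pi>
      unfolding a_def s_def using m des_le k by (rule sum_binomial_at_inf_remainder)
    have swap: "(\<Sum>n<N. \<Sum>\<pi>\<in>?P. a (des m \<pi>) n * fls_const (w \<pi>)) =
        (\<Sum>\<pi>\<in>?P. (\<Sum>n<N. a (des m \<pi>) n) * fls_const (w \<pi>))"
      unfolding sum_distrib_right by (rule sum.swap)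
    have "expand_at_inf (des_ides_gf $ m) - (\<Sum>n<N. expand_at_inf (middle_term (n + 1) $ m)) =
        (\<Sum>\<pi>\<in>?P. (s (des m \<pi>) - (\<Sum>n<N. a (des m \<pi>) n)) * fls_const (w \<pi>))"
      unfolding expand_term total swap by (simp only: left_diff_distrib sum_subtractf)
    then show "(expand_at_inf (des_ides_gf $ m) - (\<Sum>n<N. expand_at_inf (middle_term (n + 1) $ m))) $$ k = 0"
      by (simp only: fls_nth_sum fls_mult_const_nth zero mult_zero_left sum.neutral_const)
  qed
  with False show ?thesis by (simp add: rf_sums_def)
qed

theorem corollary3:
  shows "(\<forall>m. \<exists>!r. rf_sums (\<lambda>n. middle_term (n + 1) $ m) r) \<and>
         (\<forall>m. \<exists>!r. has_expansion_at_0 r (double_series m)) \<and>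
         des_ides_gf = middle_gf \<and> middle_gf = double_gf"
proof -
  \<comment> \<open>Existence and uniqueness allow the \<open>THE\<close> in
    \<open>rf_suminf\<close> and \<open>ratfun_of_expansion\<close> to be evaluated.\<close>
  have ex1: "\<exists>!r. rf_sums (\<lambda>n. middle_term (n + 1) $ m) r"
    "\<exists>!r. has_expansion_at_0 r (double_series m)" for m
    using rf_sums_middle_term[of m] rf_sums_unique has_expansion_at_0_des_ides_gf[of m] has_expansion_at_0_unique
    by (auto intro!: ex_ex1I)
  have suminf: "rf_suminf (\<lambda>n. middle_term (n + 1) $ m) = (if m = 0 then 0 else des_ides_gf $ m)" for m
    unfolding rf_suminf_def using ex1(1) rf_sums_middle_term by (rule the1_equality)
  have expansion: "ratfun_of_expansion (double_series m) = des_ides_gf $ m" for m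
    unfolding ratfun_of_expansion_def using ex1(2) has_expansion_at_0_des_ides_gf by (rule the1_equality)
  \<comment> \<open>Only the empty permutation contributes, and two sign changes turn its value into
    the constant that \<open>middle_gf\<close> adds.\<close>
  have gf0: "des_ides_gf $ 0 = 1 / ((rf_u - 1) * (rf_x - 1))"
  proof -
    have "(1 - rf_u) * (1 - rf_x) = (rf_u - 1) * (rf_x - 1)" by (simp add: algebra_simps)
    then show ?thesis by (simp add: des_ides_gf_def des_def ides_def)
  qed
  have "des_ides_gf = middle_gf"
  proof (rule fps_ext)
    fix m show "des_ides_gf $ m = middle_gf $ m"
      unfolding middle_gf_def fps_add_nth fps_nth_Abs_fps suminf using gf0 by (cases "m = 0") simp_all
  qed
  moreover have "des_ides_gf = double_gf"
    unfolding double_gf_def expansion by (rule fps_ext) simp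
  ultimately show ?thesis using ex1 by simp
qed

end
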